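(* Consider the Higgs–Kibble model with $L_1$, $Q_1$, $L_2$, $Q_2$ given in the context, with the renormalization constants $c_H=-1$ and $c_B=-1$. Then, in the third-order obstruction $$O^{(3)}\overset{\rm der}{=}3\,\mathfrak S_{xx'x''}\Big(\big\langle\tfrac{\partial Q_2}{\partial w_2}\big|O(w_2,L_1'')\big\rangle+O_{Q_2|_\delta}(L_1'')|_{I\delta}+O_{Q_2|_\delta}(L_1'')|_\delta+O_{Q_1}(L_2')|_\delta\cdot\delta_{x'x''}\Big),$$ the term $O_{Q_2|_\delta}(L_1'')|_\delta$ vanishes identically, and $O_{Q_1}(L_2')|_\delta$ vanishes if and only if the parameters $a,b$ of the Higgs self-couplings (cubic term $\mu\,aH^3$ in $L_1$, quartic term $\mu^2m^{-2}\,bH^4=\tfrac14bH^4$ in $L_2$) are $$a=-\frac12\,\frac{m_H^2}{m^2},\qquad b=-\frac14\,\frac{m_H^2}{m^2}.$$ With these values the Higgs potential becomes the shifted double-well potential; and $L_3=Q_3^\mu=0$.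
   Context: Lie algebra $\mathfrak{su}(2)$: generators $\tau_a$ ($a=1,2,3$), $[\tau_a,\tau_b]=i f_{abc}\tau_c$, $f_{abc}=\epsilon_{abc}$; inner product $\langle\tau_a|\tau_b\rangle=\delta_{ab}$, invariant: $\langle i[X,Z]|Y\rangle=\langle X|i[Z,Y]\rangle$. Fields $F,A,B,\phi,w,J$ are Lie-algebra valued, $X=X_a\tau_a$; $H$ is scalar. Products of components are Wick products (bosonic components commute); $[\cdot,\cdot]$, $\langle\cdot|\cdot\rangle$ refer only to the Lie algebra. Fields: Proca field $B_\mu$ of mass $m>0$ with $\partial_\mu B^\mu=0$, $F_{\mu\nu}=\partial_\mu B_\nu-\partial_\nu B_\mu$, $\partial_\mu F^{\mu\nu}=-m^2B^\nu$; string-localized $A_\mu=I^\nu F_{\mu\nu}$ and $\phi=I^\nu B_\nu$, where $(I^\nu f)(x)=\int d\sigma(e)c(e)e^\nu\int_0^\infty ds\,f(x+se)$ with $c$ of total weight 1 on spacelike unit vectors; $\partial_\mu\phi=A_\mu-B_\mu$, $\partial_\mu A^\mu=-m^2\phi$, $\partial_\mu A_\nu-\partial_\nu A_\mu=F_{\mu\nu}$. String variation $\delta_c$ (derivation): $\delta_cA_\mu=\partial_\mu w$, $\delta_c\phi=w$, zero on $B,F,H,J$. $H$ is a free scalar of mass $m_H>0$. $J^\mu=\mathsf c\,j^\mu+\mathsf c_5\,j^{\mu5}$ is a conserved massless-fermion current ($j_a^\mu=\bar\psi\gamma^\mu\tau_a\psi$, $j_a^{\mu5}=\bar\psi\gamma^\mu\gamma^5\tau_a\psi$),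 with $(\mathsf c,\mathsf c_5)=(1,0)$ or $(\tfrac12,\pm\tfrac12)$. First order, with $\mu=\tfrac12m$ (coupling constant $g$): $L_1=\langle A_\mu|J^\mu\rangle+\tfrac12\langle F^{\mu\nu}|i[A_\mu,A_\nu]\rangle-\tfrac12m^2\langle\phi|i[A^\mu,B_\mu]\rangle+\mu\big(\langle A_\mu|B^\mu\rangle H+\langle A_\mu|\phi\rangle\partial^\mu H-\tfrac{m_H^2}2\langle\phi|\phi\rangle H+aH^3\big)$, $Q_1^\mu=\langle w|J^\mu\rangle+\langle F^{\mu\nu}|i[w,A_\nu]\rangle-\tfrac12m^2\langle\phi|i[w,B^\mu]\rangle+\mu\big(\langle w|B^\mu\rangle H+\langle w|\phi\rangle\partial^\mu H\big)$. Second order, for $c_H=c_B=-1$ ($c_F\in\mathbb R$ arbitrary): $L_2=L_{2,\mathrm{self}}+L_{2,\mathrm{Higgs}}$, $L_{2,\mathrm{self}}=-\tfrac12(1+c_F)\langle i[A_\kappa,A_\lambda]|i[A^\kappa,A^\lambda]\rangle$, $L_{2,\mathrm{Higgs}}=\tfrac{m^2}4\big((3a+\tfrac{m_H^2}{m^2})\langle\phi|\phi\rangle H^2-\tfrac{m_H^2}4\langle\phi|\phi\rangle\langle\phi|\phi\rangle\big)+\tfrac14bH^4$; $Q_2^\mu(x;x')=Q_2^\mu|_{I\delta}+Q_2^\mu|_\delta$ with $Q_2^\mu|_{I\delta}=2\langle\frac{\partial Q_1^\mu}{\partial w}(x)|w_2(x,x')\rangle$, $w_2(x,x')=i[w(x'),A_\nu(x')]\cdot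 I^\nu\delta_{xx'}$, and $Q_2^\mu|_\delta=\langle\frac{\partial L_{2,\mathrm{self}}}{\partial A_\mu}|w\rangle\,\delta_{xx'}$. Higgs potential: $\tfrac12m_H^2H^2$ minus the part of $gL_1+\tfrac{g^2}2L_2$ that is a polynomial in $H$ alone; "shifted double-well" means of the form $\lambda H^2(H+v)^2$. Third order: $L_3$ and $Q_3^\mu$ are the quantities that resolve the third-order obstruction, $O^{(3)}=3\mathfrak S_{xx'x''}\big(O_{Q_2}(L_1'')+O_{Q_1}(L_2')\delta_{x'x''}\big)\overset!=\delta_cL_3\cdot i\delta_{xx'x''}-i\mathfrak S_{xx'x''}\partial_\mu Q_3^\mu(x;x',x'')$. Equality $\overset{\rm der}{=}$ means equality up to total derivatives; the terms of $O^{(3)}$ proportional to $w_2$ cancel a priori up to total derivatives, which gives the form of $O^{(3)}$ displayed in the claim. Its first two terms are dealt with beforehand, by either of two options: with a sharp string (where $w_2=0$) and suitably renormalized propagators of $\partial_\mu A_\nu$ they are separately total derivatives; or, redefining the propagators such that all two-point obstructions $O_\mu(A_\nu,\cdot)$ are zero, they vanish. The resolution of $O^{(3)}$ is thereby reduced to that of the last two terms. Obstruction map (tree level): $O_{Y}(X')=[T,\partial_\mu]Y^\mu(x)X(x')$ is the sum over all ways of replacing one factor $\varphi$ in $Y^\mu(x)$ and one factor $\chi$ in $X(x')$ by the two-point obstruction $O_\mu(\varphi(x),\chi(x'))$; moreover $\mathfrak S_{xx'}O_{Y\cdot\delta_{xx'}}(X'')=\tfrac12O_Y(X'')\delta_{xx'}$.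 $|_\delta$ denotes the part without, and $|_{I\delta}$ the part with, string-integrated delta functions; $\mathfrak S$ is the average over permutations of arguments; primes on fields indicate arguments $x',x''$; $T^{[\kappa}S^{\lambda]}=T^\kappa S^\lambda-T^\lambda S^\kappa$; a prime on $I$ means string integration in $x'$. Two-point obstructions as operators acting on $i\delta_{xx'}=i\delta(x-x')$ (times $\delta_{ab}$ in the Proca sector), for $c_H=c_B=-1$: $O_\mu(H,H')=0$, $O_\mu(H,\partial'^\kappa H')=-\delta_\mu^\kappa$, $O_\mu(\partial^\mu H,H')=1$, $O_\mu(\partial^\mu H,\partial'^\kappa H')=0$; $O_\mu(J_a^\mu,J_b'^\kappa)=-f_{abc}J^\kappa_c$; $O_\mu(B^\mu,\cdot)$: $0$ on $B'$, $-m^{-2}$ on $\phi'$, $0$ on $F'$, $0$ on $A'$; $O_\mu(F^{\mu\nu},\cdot)$: $0$ on $B'$, $-I'^\nu$ on $\phi'$, $-(1+c_F)\eta^{\nu[\kappa}\partial^{\lambda]}$ on $F'^{\kappa\lambda}$, $-(\eta^{\nu\kappa}-I'^\nu\partial^\kappa)$ on $A'^\kappa$; $O_\mu(\phi,\cdot)$: $m^{-2}\delta_\mu^\kappa$ on $B'^\kappa$, $0$ on $\phi',F',A'$; $O_\mu(w,\cdot)=0$; the $\delta$-part of $O_\mu(A_\nu,\cdot)$: $-\tfrac12c_F\delta_\mu^{[\kappa}\delta_\nu^{\lambda]}$ on $F'^{\kappa\lambda}$, $0$ on $A',B',\phi'$ (all other contributions to $O_\mu(A_\nu,\cdot)$ are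 string-integrated). Two-point obstructions between different sectors (Proca, Higgs, Dirac) vanish. *)

theory Defs
  imports
    "HOL-Analysis.Analysis"
    "HOL-Library.Poly_Mapping"
    "HOL-Library.Multiset"
begin

section \<open>Polynomials in arbitrarily many commuting variables\<close>

type_synonym 'v mpoly = "('v \<Rightarrow>\<^sub>0 nat) \<Rightarrow>\<^sub>0 complex"

definition Const :: "complex \<Rightarrow> 'v mpoly" where
  "Const z = Poly_Mapping.single 0 z"

abbreviation Rc :: "real \<Rightarrow> 'v mpoly" where
  "Rc r \<equiv> Const (complex_of_real r)"

definition Var :: "'v \<Rightarrow> 'v mpoly" where
  "Var v = Poly_Mapping.single (Poly_Mapping.single v 1) 1"

definition vars :: "'v mpoly \<Rightarrow> 'v set" where
  "vars p = (\<Union>k\<in>Poly_Mapping.keys p. Poly_Mapping.keys k)"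

definition pd :: "'v \<Rightarrow> 'v mpoly \<Rightarrow> 'v mpoly" where
  "pd v p = (\<Sum>k\<in>Poly_Mapping.keys p.
     Poly_Mapping.single (k - Poly_Mapping.single v 1)
       (of_nat (Poly_Mapping.lookup k v) * Poly_Mapping.lookup p k))"

text \<open>The algebra homomorphism, and the derivation, with prescribed values on the variables.\<close>

definition poly_subst :: "('v \<Rightarrow> 'u mpoly) \<Rightarrow> 'v mpoly \<Rightarrow> 'u mpoly" where
  "poly_subst s p = (\<Sum>k\<in>Poly_Mapping.keys p.
     Const (Poly_Mapping.lookup p k) *
     (\<Prod>v\<in>Poly_Mapping.keys k. s v ^ Poly_Mapping.lookup k v))"

definition derivation :: "('v \<Rightarrow> 'v mpoly) \<Rightarrow> 'v mpoly \<Rightarrow> 'v mpoly" where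
  "derivation d p = (\<Sum>v\<in>vars p. pd v p * d v)"


section \<open>Indices\<close>

text \<open>Lorentz indices range over the four-element type \<open>4\<close>, whose element \<open>0\<close> is the time
  direction (signature \<open>+---\<close>); Lie algebra indices range over the three-element type \<open>3\<close>
  with elements \<open>1\<close>, \<open>2\<close>, \<open>3\<close>.\<close>

definition eta :: "4 \<Rightarrow> 4 \<Rightarrow> real" where
  "eta \<mu> \<nu> = (if \<mu> \<noteq> \<nu> then 0 else if \<mu> = 0 then 1 else -1)"

definition kd :: "'i \<Rightarrow> 'i \<Rightarrow> real" where
  "kd i j = (if i = j then 1 else 0)"

definition eps :: "3 \<Rightarrow> 3 \<Rightarrow> 3 \<Rightarrow> real" where
  "eps a b c =
    (if (a, b, c) \<in> {(1,2,3), (2,3,1), (3,1,2)} then 1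
     else if (a, b, c) \<in> {(2,1,3), (1,3,2), (3,2,1)} then -1 else 0)"


section \<open>The Lie algebra su(2), with polynomial coefficients\<close>

text \<open>\<open>X = X\<^sub>a \<tau>\<^sub>a\<close> is represented by its components in the orthonormal basis
  \<open>\<tau>\<^sub>a\<close>, with \<open>[\<tau>\<^sub>a, \<tau>\<^sub>b] = \<i> \<epsilon>\<^sub>a\<^sub>b\<^sub>c \<tau>\<^sub>c\<close>.\<close>

type_synonym 'v lie = "3 \<Rightarrow> 'v mpoly"

definition bracket :: "'v lie \<Rightarrow> 'v lie \<Rightarrow> 'v lie" where
  "bracket X Y c = (\<Sum>a\<in>UNIV. \<Sum>b\<in>UNIV. Const (\<i> * complex_of_real (eps a b c)) * X a * Y b)"

definition ibr :: "'v lie \<Rightarrow> 'v lie \<Rightarrow> 'v lie" where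
  "ibr X Y c = Const \<i> * bracket X Y c"

definition ip :: "'v lie \<Rightarrow> 'v lie \<Rightarrow> 'v mpoly" where
  "ip X Y = (\<Sum>a\<in>UNIV. X a * Y a)"


section \<open>Fields\<close>

text \<open>All Lorentz indices of the generators, including those of derivatives, are upper.
  \<open>Jet D f\<close> is \<open>\<partial>\<^sup>D f\<close>, where \<open>D\<close> is the multiset of upper derivative
  indices. The two fermion currents (vector and axial) are \<open>FJ\<close> and \<open>FJ5\<close>.\<close>

datatype field = FA 4 3 | FB 4 3 | FF 4 4 3 | FPhi 3 | FW 3 | FJ 4 3 | FJ5 4 3 | FH

datatype jet = Jet "4 multiset" field

type_synonym wick = "jet mpoly"

definition jD :: "4 \<Rightarrow> jet \<Rightarrow> jet" where
  "jD \<kappa> j = (case j of Jet D f \<Rightarrow> Jet (add_mset \<kappa> D) f)"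

text \<open>\<open>\<partial>\<^sup>\<kappa>\<close> on Wick polynomials.\<close>
definition dW :: "4 \<Rightarrow> wick \<Rightarrow> wick" where
  "dW \<kappa> = derivation (\<lambda>j. Var (jD \<kappa> j))"

definition low :: "(4 \<Rightarrow> jet lie) \<Rightarrow> 4 \<Rightarrow> jet lie" where
  "low X \<mu> a = (\<Sum>\<nu>\<in>UNIV. Rc (eta \<mu> \<nu>) * X \<nu> a)"

abbreviation jA :: "4 \<Rightarrow> 3 \<Rightarrow> jet" where "jA \<kappa> a \<equiv> Jet {#} (FA \<kappa> a)"
abbreviation jB :: "4 \<Rightarrow> 3 \<Rightarrow> jet" where "jB \<kappa> a \<equiv> Jet {#} (FB \<kappa> a)"
abbreviation jF :: "4 \<Rightarrow> 4 \<Rightarrow> 3 \<Rightarrow> jet" where "jF \<kappa> \<sigma> a \<equiv> Jet {#} (FF \<kappa> \<sigma> a)"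
abbreviation jPhi :: "3 \<Rightarrow> jet" where "jPhi a \<equiv> Jet {#} (FPhi a)"
abbreviation jW :: "3 \<Rightarrow> jet" where "jW a \<equiv> Jet {#} (FW a)"
abbreviation jH :: jet where "jH \<equiv> Jet {#} FH"
abbreviation jdH :: "4 \<Rightarrow> jet" where "jdH \<kappa> \<equiv> Jet {#\<kappa>#} FH"
abbreviation jJ :: "4 \<Rightarrow> 3 \<Rightarrow> jet" where "jJ \<kappa> a \<equiv> Jet {#} (FJ \<kappa> a)"
abbreviation jJ5 :: "4 \<Rightarrow> 3 \<Rightarrow> jet" where "jJ5 \<kappa> a \<equiv> Jet {#} (FJ5 \<kappa> a)"

definition Af :: "4 \<Rightarrow> jet lie" where "Af \<kappa> a = Var (jA \<kappa> a)"
definition Bf :: "4 \<Rightarrow> jet lie" where "Bf \<kappa> a = Var (jB \<kappa> a)"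
definition Ff :: "4 \<Rightarrow> 4 \<Rightarrow> jet lie" where "Ff \<kappa> \<sigma> a = Var (jF \<kappa> \<sigma> a)"
definition phi :: "jet lie" where "phi a = Var (jPhi a)"
definition Wf :: "jet lie" where "Wf a = Var (jW a)"
definition Hf :: wick where "Hf = Var jH"
definition dHf :: "4 \<Rightarrow> wick" where "dHf \<kappa> = Var (jdH \<kappa>)"
definition Jf :: "real \<Rightarrow> real \<Rightarrow> 4 \<Rightarrow> jet lie" where
  "Jf c c5 \<kappa> a = Rc c * Var (jJ \<kappa> a) + Rc c5 * Var (jJ5 \<kappa> a)"

text \<open>The linear field equations, as elements of the polynomial algebra that vanish. The
  Klein--Gordon equation for \<open>w\<close> is the string variation of
  \<open>\<partial>\<^sub>\<mu> A\<^sup>\<mu> = - m\<^sup>2 \<phi>\<close>.\<close>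

inductive_set field_eqs :: "real \<Rightarrow> real \<Rightarrow> real \<Rightarrow> real \<Rightarrow> wick set"
  for c c5 m mH :: real where
  div_B: "(\<Sum>\<mu>\<in>UNIV. dW \<mu> (low Bf \<mu> a)) \<in> field_eqs c c5 m mH"
| F_B: "Ff \<mu> \<nu> a - (dW \<mu> (Bf \<nu> a) - dW \<nu> (Bf \<mu> a)) \<in> field_eqs c c5 m mH"
| div_F: "(\<Sum>\<mu>\<in>UNIV. dW \<mu> (low (\<lambda>\<kappa>. Ff \<kappa> \<nu>) \<mu> a)) + Rc (m^2) * Bf \<nu> a
    \<in> field_eqs c c5 m mH"
| d_phi: "dW \<mu> (phi a) - (Af \<mu> a - Bf \<mu> a) \<in> field_eqs c c5 m mH"
| div_A: "(\<Sum>\<mu>\<in>UNIV. dW \<mu> (low Af \<mu> a)) + Rc (m^2) * phi a \<in> field_eqs c c5 m mH"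
| F_A: "Ff \<mu> \<nu> a - (dW \<mu> (Af \<nu> a) - dW \<nu> (Af \<mu> a)) \<in> field_eqs c c5 m mH"
| KG_w: "(\<Sum>\<mu>\<in>UNIV. \<Sum>\<nu>\<in>UNIV. Rc (eta \<mu> \<nu>) * dW \<mu> (dW \<nu> (Wf a))) + Rc (m^2) * Wf a
    \<in> field_eqs c c5 m mH"
| KG_H: "(\<Sum>\<mu>\<in>UNIV. \<Sum>\<nu>\<in>UNIV. Rc (eta \<mu> \<nu>) * dW \<mu> (dW \<nu> Hf)) + Rc (mH^2) * Hf
    \<in> field_eqs c c5 m mH"
| div_J: "(\<Sum>\<mu>\<in>UNIV. dW \<mu> (low (Jf c c5) \<mu> a)) \<in> field_eqs c c5 m mH"

text \<open>The string variation. It is only used on polynomials without \<open>w\<close>; its value on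
  \<open>w\<close> is set to zero.\<close>

definition string_var :: "wick \<Rightarrow> wick" where
  "string_var = derivation (\<lambda>j. case j of
       Jet D (FA \<mu> a) \<Rightarrow> Var (Jet (add_mset \<mu> D) (FW a))
     | Jet D (FPhi a) \<Rightarrow> Var (Jet D (FW a))
     | _ \<Rightarrow> 0)"


section \<open>Interactions\<close>

definition L1 :: "real \<Rightarrow> real \<Rightarrow> real \<Rightarrow> real \<Rightarrow> real \<Rightarrow> wick" where
  "L1 c c5 m mH a =
     (\<Sum>\<mu>\<in>UNIV. ip (low Af \<mu>) (Jf c c5 \<mu>))
   + Rc (1/2) * (\<Sum>\<mu>\<in>UNIV. \<Sum>\<nu>\<in>UNIV. ip (Ff \<mu> \<nu>) (ibr (low Af \<mu>) (low Af \<nu>)))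
   - Rc (m^2 / 2) * (\<Sum>\<mu>\<in>UNIV. ip phi (ibr (Af \<mu>) (low Bf \<mu>)))
   + Rc (m/2) *
      ((\<Sum>\<mu>\<in>UNIV. ip (low Af \<mu>) (Bf \<mu>)) * Hf
       + (\<Sum>\<mu>\<in>UNIV. ip (low Af \<mu>) phi * dHf \<mu>)
       - Rc (mH^2 / 2) * ip phi phi * Hf
       + Rc a * Hf ^ 3)"

definition Q1 :: "real \<Rightarrow> real \<Rightarrow> real \<Rightarrow> 4 \<Rightarrow> wick" where
  "Q1 c c5 m \<mu> =
     ip Wf (Jf c c5 \<mu>)
   + (\<Sum>\<nu>\<in>UNIV. ip (Ff \<mu> \<nu>) (ibr Wf (low Af \<nu>)))
   - Rc (m^2 / 2) * ip phi (ibr Wf (Bf \<mu>))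
   + Rc (m/2) * (ip Wf (Bf \<mu>) * Hf + ip Wf phi * dHf \<mu>)"

definition L2_self :: "real \<Rightarrow> wick" where
  "L2_self cF = - Rc ((1 + cF) / 2) *
     (\<Sum>\<kappa>\<in>UNIV. \<Sum>\<sigma>\<in>UNIV. ip (ibr (low Af \<kappa>) (low Af \<sigma>)) (ibr (Af \<kappa>) (Af \<sigma>)))"

definition L2_Higgs :: "real \<Rightarrow> real \<Rightarrow> real \<Rightarrow> real \<Rightarrow> wick" where
  "L2_Higgs m mH a b =
     Rc (m^2 / 4) * (Rc (3 * a + mH^2 / m^2) * ip phi phi * Hf ^ 2
                     - Rc (mH^2 / 4) * ip phi phi * ip phi phi)
   + Rc (b / 4) * Hf ^ 4"

definition L2 :: "real \<Rightarrow> real \<Rightarrow> real \<Rightarrow> real \<Rightarrow> real \<Rightarrow> wick" where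
  "L2 cF m mH a b = L2_self cF + L2_Higgs m mH a b"

text \<open>The factor \<open>\<langle>\<partial>L\<^sub>2\<^sub>,\<^sub>s\<^sub>e\<^sub>l\<^sub>f/\<partial>A\<^sub>\<mu> | w\<rangle>\<close> of
  \<open>\<delta>(x-x')\<close> in the local part of \<open>Q\<^sub>2\<close>; the metric accounts for the generators
  being the upper components of \<open>A\<close>.\<close>

definition Q2_loc :: "real \<Rightarrow> 4 \<Rightarrow> wick" where
  "Q2_loc cF \<mu> =
     ip (\<lambda>a. \<Sum>\<rho>\<in>UNIV. Rc (eta \<mu> \<rho>) * pd (jA \<rho> a) (L2_self cF)) Wf"


section \<open>Higgs potential\<close>

text \<open>The monomials of \<open>p\<close> in which no variable other than the undifferentiated \<open>H\<close> occurs.\<close>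
definition H_part :: "wick \<Rightarrow> wick" where
  "H_part p = (\<Sum>k\<in>{k \<in> Poly_Mapping.keys p. Poly_Mapping.keys k \<subseteq> {jH}}.
     Poly_Mapping.single k (Poly_Mapping.lookup p k))"

definition Higgs_potential ::
  "real \<Rightarrow> real \<Rightarrow> real \<Rightarrow> real \<Rightarrow> real \<Rightarrow> real \<Rightarrow> real \<Rightarrow> real \<Rightarrow> wick" where
  "Higgs_potential g c c5 cF m mH a b =
     Rc (mH^2 / 2) * Hf ^ 2
     - H_part (Rc g * L1 c c5 m mH a + Rc (g^2 / 2) * L2 cF m mH a b)"

text \<open>\<open>\<alpha> > 0\<close> and \<open>v \<noteq> 0\<close> exclude the degenerate cases without two minima.\<close>
definition shifted_double_well :: "wick \<Rightarrow> bool" where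
  "shifted_double_well V \<longleftrightarrow>
     (\<exists>\<alpha> v :: real. \<alpha> > 0 \<and> v \<noteq> 0 \<and> V = Rc \<alpha> * Hf ^ 2 * (Hf + Rc v) ^ 2)"


section \<open>Two-point obstructions\<close>

text \<open>Operators acting on \<open>\<delta>(x-x')\<close>, with coefficients that are Wick polynomials at
  \<open>x\<close>: products (multisets) of \<open>\<partial>\<^sup>\<kappa>\<close> (with respect to \<open>x\<close>), and of the
  string integrations \<open>I\<^sup>\<nu>\<close> in \<open>x\<close> and \<open>I'\<^sup>\<nu>\<close> in \<open>x'\<close>. All of
  these commute on \<open>\<delta>(x-x')\<close>.\<close>

datatype opsym = Dop 4 | Iop 4 | Iop' 4

type_synonym opval = "opsym multiset \<Rightarrow>\<^sub>0 wick"

definition opc :: "wick \<Rightarrow> opval" where "opc c = Poly_Mapping.single {#} c"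
definition opr :: "real \<Rightarrow> opval" where "opr r = opc (Rc r)"
definition ops :: "opsym \<Rightarrow> opval" where "ops s = Poly_Mapping.single {#s#} 1"

definition stringy :: "opsym multiset \<Rightarrow> bool" where
  "stringy D \<longleftrightarrow> (\<exists>s \<in># D. \<exists>\<nu>. s = Iop \<nu> \<or> s = Iop' \<nu>)"

definition delta_part :: "opval \<Rightarrow> opval" where
  "delta_part v = (\<Sum>D\<in>{D \<in> Poly_Mapping.keys v. \<not> stringy D}.
     Poly_Mapping.single D (Poly_Mapping.lookup v D))"

definition string_part :: "opval \<Rightarrow> opval" where
  "string_part v = (\<Sum>D\<in>{D \<in> Poly_Mapping.keys v. stringy D}.
     Poly_Mapping.single D (Poly_Mapping.lookup v D))"

text \<open>\<open>Ob \<mu> \<phi> \<psi>\<close> is the operator that gives \<open>O\<^sub>\<mu>(\<phi>(x), \<psi>(x'))\<close> when applied to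
  \<open>\<i> \<delta>(x-x')\<close>.\<close>

type_synonym two_point = "4 \<Rightarrow> jet \<Rightarrow> jet \<Rightarrow> opval"

datatype sector = Proca | Higgs | Dirac

definition sector :: "jet \<Rightarrow> sector" where
  "sector j = (case j of Jet D f \<Rightarrow> (case f of
      FH \<Rightarrow> Higgs | FJ _ _ \<Rightarrow> Dirac | FJ5 _ _ \<Rightarrow> Dirac | _ \<Rightarrow> Proca))"

text \<open>The table of two-point obstructions for \<open>c\<^sub>H = c\<^sub>B = -1\<close>. Where only the contraction
  with the obstruction index \<open>\<mu>\<close> is known, only this contraction is prescribed; the
  string-integrated part of \<open>O\<^sub>\<mu>(A\<^sub>\<nu>, \<sqdot>)\<close> is left arbitrary. Antisymmetry in the
  indices of \<open>F\<close> is required because \<open>FF \<kappa> \<sigma>\<close> and \<open>FF \<sigma> \<kappa>\<close>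
  are separate generators.\<close>

definition HK_two_point ::
  "real \<Rightarrow> real \<Rightarrow> real \<Rightarrow> real \<Rightarrow> two_point \<Rightarrow> bool" where
  "HK_two_point c c5 m cF Ob \<longleftrightarrow>
    \<comment> \<open>different sectors\<close>
    (\<forall>\<mu> \<phi> \<psi>. sector \<phi> \<noteq> sector \<psi> \<longrightarrow> Ob \<mu> \<phi> \<psi> = 0) \<and>
    \<comment> \<open>antisymmetry of \<open>F\<close>\<close>
    (\<forall>\<mu> \<kappa> \<sigma> a \<psi>. Ob \<mu> (jF \<kappa> \<sigma> a) \<psi> = - Ob \<mu> (jF \<sigma> \<kappa> a) \<psi>) \<and>
    (\<forall>\<mu> \<kappa> \<sigma> a \<phi>. Ob \<mu> \<phi> (jF \<kappa> \<sigma> a) = - Ob \<mu> \<phi> (jF \<sigma> \<kappa> a)) \<and>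
    \<comment> \<open>Higgs sector\<close>
    (\<forall>\<mu>. Ob \<mu> jH jH = 0) \<and>
    (\<forall>\<mu> \<kappa>. Ob \<mu> jH (jdH \<kappa>) = - opr (kd \<mu> \<kappa>)) \<and>
    (\<Sum>\<mu>\<in>UNIV. Ob \<mu> (jdH \<mu>) jH) = 1 \<and>
    (\<forall>\<kappa>. (\<Sum>\<mu>\<in>UNIV. Ob \<mu> (jdH \<mu>) (jdH \<kappa>)) = 0) \<and>
    \<comment> \<open>Dirac sector: bilinearity in \<open>J = c j + c5 j5\<close>\<close>
    (\<forall>\<kappa> a b. (\<Sum>\<mu>\<in>UNIV.
        opr (c * c) * Ob \<mu> (jJ \<mu> a) (jJ \<kappa> b) + opr (c * c5) * Ob \<mu> (jJ \<mu> a) (jJ5 \<kappa> b)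
      + opr (c5 * c) * Ob \<mu> (jJ5 \<mu> a) (jJ \<kappa> b) + opr (c5 * c5) * Ob \<mu> (jJ5 \<mu> a) (jJ5 \<kappa> b))
      = - opc (\<Sum>d\<in>UNIV. Rc (eps a b d) * Jf c c5 \<kappa> d)) \<and>
    \<comment> \<open>\<open>B\<close>\<close>
    (\<forall>a b \<kappa> \<sigma>.
      (\<Sum>\<mu>\<in>UNIV. Ob \<mu> (jB \<mu> a) (jB \<kappa> b)) = 0 \<and>
      (\<Sum>\<mu>\<in>UNIV. Ob \<mu> (jB \<mu> a) (jPhi b)) = - opr (kd a b / m^2) \<and>
      (\<Sum>\<mu>\<in>UNIV. Ob \<mu> (jB \<mu> a) (jF \<kappa> \<sigma> b)) = 0 \<and>
      (\<Sum>\<mu>\<in>UNIV. Ob \<mu> (jB \<mu> a) (jA \<kappa> b)) = 0) \<and>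
    \<comment> \<open>\<open>F\<close>\<close>
    (\<forall>\<nu> a b \<kappa> \<sigma>.
      (\<Sum>\<mu>\<in>UNIV. Ob \<mu> (jF \<mu> \<nu> a) (jB \<kappa> b)) = 0 \<and>
      (\<Sum>\<mu>\<in>UNIV. Ob \<mu> (jF \<mu> \<nu> a) (jPhi b)) = - opr (kd a b) * ops (Iop' \<nu>) \<and>
      (\<Sum>\<mu>\<in>UNIV. Ob \<mu> (jF \<mu> \<nu> a) (jF \<kappa> \<sigma> b)) =
        - opr (kd a b * (1 + cF)) *
          (opr (eta \<nu> \<kappa>) * ops (Dop \<sigma>) - opr (eta \<nu> \<sigma>) * ops (Dop \<kappa>)) \<and>
      (\<Sum>\<mu>\<in>UNIV. Ob \<mu> (jF \<mu> \<nu> a) (jA \<kappa> b)) =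
        - opr (kd a b) * (opr (eta \<nu> \<kappa>) - ops (Iop' \<nu>) * ops (Dop \<kappa>))) \<and>
    \<comment> \<open>\<open>\<phi>\<close>\<close>
    (\<forall>\<mu> a b \<kappa> \<sigma>.
      Ob \<mu> (jPhi a) (jB \<kappa> b) = opr (kd a b / m^2 * kd \<mu> \<kappa>) \<and>
      Ob \<mu> (jPhi a) (jPhi b) = 0 \<and>
      Ob \<mu> (jPhi a) (jF \<kappa> \<sigma> b) = 0 \<and>
      Ob \<mu> (jPhi a) (jA \<kappa> b) = 0) \<and>
    \<comment> \<open>\<open>w\<close>\<close>
    (\<forall>\<mu> a \<psi>. Ob \<mu> (jW a) \<psi> = 0) \<and>
    \<comment> \<open>\<open>A\<close>, with its index lowered\<close>
    (\<forall>\<mu> \<nu> a b \<kappa> \<sigma>.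
      delta_part (\<Sum>\<rho>\<in>UNIV. opr (eta \<nu> \<rho>) * Ob \<mu> (jA \<rho> a) (jF \<kappa> \<sigma> b)) =
        - opr (kd a b * cF / 2 * (kd \<mu> \<kappa> * kd \<nu> \<sigma> - kd \<mu> \<sigma> * kd \<nu> \<kappa>)) \<and>
      delta_part (\<Sum>\<rho>\<in>UNIV. opr (eta \<nu> \<rho>) * Ob \<mu> (jA \<rho> a) (jA \<kappa> b)) = 0 \<and>
      delta_part (\<Sum>\<rho>\<in>UNIV. opr (eta \<nu> \<rho>) * Ob \<mu> (jA \<rho> a) (jB \<kappa> b)) = 0 \<and>
      delta_part (\<Sum>\<rho>\<in>UNIV. opr (eta \<nu> \<rho>) * Ob \<mu> (jA \<rho> a) (jPhi b)) = 0)"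


section \<open>Expressions in three spacetime points\<close>

datatype pt = x0 | x1 | x2

text \<open>\<open>At p j\<close> is the field \<open>j\<close> at the point \<open>p\<close>; \<open>Del p q D\<close> is
  \<open>D \<delta>(p-q)\<close>, where \<open>Dop\<close> and \<open>Iop\<close> act on \<open>p\<close>, and \<open>Iop'\<close> on \<open>q\<close>.\<close>

datatype sym = At pt jet | Del pt pt "opsym multiset"

type_synonym npt = "sym mpoly"

definition place :: "pt \<Rightarrow> wick \<Rightarrow> npt" where
  "place p = poly_subst (\<lambda>j. Var (At p j))"

definition delta :: "pt \<Rightarrow> pt \<Rightarrow> npt" where
  "delta p q = Var (Del p q {#})"

text \<open>\<open>\<partial>\<^sup>\<kappa>\<close> with respect to the point \<open>p\<close>.\<close>
definition dN :: "pt \<Rightarrow> 4 \<Rightarrow> npt \<Rightarrow> npt" where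
  "dN p \<kappa> = derivation (\<lambda>s. case s of
       At q j \<Rightarrow> (if p = q then Var (At q (jD \<kappa> j)) else 0)
     | Del q r D \<Rightarrow> (if p = q then Var (Del q r (add_mset (Dop \<kappa>) D)) else 0)
                  - (if p = r then Var (Del q r (add_mset (Dop \<kappa>) D)) else 0))"

definition divN :: "pt \<Rightarrow> (4 \<Rightarrow> npt) \<Rightarrow> npt" where
  "divN p V = (\<Sum>\<mu>\<in>UNIV. \<Sum>\<nu>\<in>UNIV. Rc (eta \<mu> \<nu>) * dN p \<nu> (V \<mu>))"

definition swap_op :: "opsym \<Rightarrow> opsym" where
  "swap_op s = (case s of Dop \<kappa> \<Rightarrow> Dop \<kappa> | Iop \<nu> \<Rightarrow> Iop' \<nu> | Iop' \<nu> \<Rightarrow> Iop \<nu>)"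

definition ord_op :: "opsym multiset \<Rightarrow> nat" where
  "ord_op D = size (filter_mset (\<lambda>s. \<exists>\<kappa>. s = Dop \<kappa>) D)"

text \<open>The differential ideal of expressions that vanish: generated by the field equations, the
  reflection \<open>\<delta>(p-q) = \<delta>(q-p)\<close>, the localization property of the delta function,
  and \<open>I\<^sup>\<nu>\<partial>\<^sub>\<nu> = -1\<close> (which expresses that \<open>c\<close> has total weight one; on
  \<open>\<delta>(p-q)\<close> it becomes \<open>I'\<^sup>\<nu>\<partial>\<^sub>\<nu> = +1\<close> for integration in \<open>q\<close>).\<close>

inductive_set null_ideal :: "real \<Rightarrow> real \<Rightarrow> real \<Rightarrow> real \<Rightarrow> npt set"
  for c c5 m mH :: real where
  field_eq: "r \<in> field_eqs c c5 m mH \<Longrightarrow> place p r \<in> null_ideal c c5 m mH"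
| reflect: "p \<noteq> q \<Longrightarrow>
    Var (Del p q D) - Const ((-1) ^ ord_op D) * Var (Del q p (image_mset swap_op D))
      \<in> null_ideal c c5 m mH"
| localize: "p \<noteq> q \<Longrightarrow>
    (Var (At p j) - Var (At q j)) * delta p q \<in> null_ideal c c5 m mH"
| localize_Del: "p \<noteq> q \<Longrightarrow> p \<noteq> r \<Longrightarrow> q \<noteq> r \<Longrightarrow>
    (Var (Del p r D) - Var (Del q r D)) * delta p q \<in> null_ideal c c5 m mH"
| string: "p \<noteq> q \<Longrightarrow>
    (\<Sum>\<nu>\<in>UNIV. \<Sum>\<sigma>\<in>UNIV. Rc (eta \<nu> \<sigma>) * Var (Del p q (D + {#Iop \<nu>, Dop \<sigma>#})))
      + Var (Del p q D) \<in> null_ideal c c5 m mH"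
| string': "p \<noteq> q \<Longrightarrow>
    (\<Sum>\<nu>\<in>UNIV. \<Sum>\<sigma>\<in>UNIV. Rc (eta \<nu> \<sigma>) * Var (Del p q (D + {#Iop' \<nu>, Dop \<sigma>#})))
      - Var (Del p q D) \<in> null_ideal c c5 m mH"
| add: "e \<in> null_ideal c c5 m mH \<Longrightarrow> f \<in> null_ideal c c5 m mH \<Longrightarrow>
    e + f \<in> null_ideal c c5 m mH"
| mult: "e \<in> null_ideal c c5 m mH \<Longrightarrow> f * e \<in> null_ideal c c5 m mH"
| deriv: "e \<in> null_ideal c c5 m mH \<Longrightarrow> dN p \<kappa> e \<in> null_ideal c c5 m mH"

definition eqv :: "real \<Rightarrow> real \<Rightarrow> real \<Rightarrow> real \<Rightarrow> npt \<Rightarrow> npt \<Rightarrow> bool" where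
  "eqv c c5 m mH e f \<longleftrightarrow> e - f \<in> null_ideal c c5 m mH"

text \<open>Equality up to total derivatives.\<close>
definition eq_der :: "real \<Rightarrow> real \<Rightarrow> real \<Rightarrow> real \<Rightarrow> npt \<Rightarrow> npt \<Rightarrow> bool" where
  "eq_der c c5 m mH e f \<longleftrightarrow>
     (\<exists>V :: pt \<Rightarrow> 4 \<Rightarrow> npt. eqv c c5 m mH e (f + (\<Sum>p\<in>{x0, x1, x2}. divN p (V p))))"

text \<open>The average over the permutations of the three points.\<close>

definition permute_pts :: "(pt \<Rightarrow> pt) \<Rightarrow> npt \<Rightarrow> npt" where
  "permute_pts \<pi> = poly_subst (\<lambda>s. case s of
       At p j \<Rightarrow> Var (At (\<pi> p) j)
     | Del p q D \<Rightarrow> Var (Del (\<pi> p) (\<pi> q) D))"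

definition symm :: "npt \<Rightarrow> npt" where
  "symm e = Rc (1/6) * (\<Sum>\<pi>\<in>{\<pi>. bij \<pi>}. permute_pts \<pi> e)"


section \<open>The obstruction map\<close>

definition op_apply :: "pt \<Rightarrow> pt \<Rightarrow> opval \<Rightarrow> npt" where
  "op_apply p q v = (\<Sum>D\<in>Poly_Mapping.keys v.
     place p (Poly_Mapping.lookup v D) * (Const \<i> * Var (Del p q D)))"

text \<open>\<open>O\<^sub>Y(X)\<close> with \<open>Y\<close> at \<open>p\<close> and \<open>X\<close> at \<open>q\<close>. As it is linear in
  \<open>Ob\<close>, its parts without and with string-integrated delta functions are obtained from the
  corresponding parts of \<open>Ob\<close>.\<close>

definition obs :: "two_point \<Rightarrow> pt \<Rightarrow> pt \<Rightarrow> (4 \<Rightarrow> wick) \<Rightarrow> wick \<Rightarrow> npt" where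
  "obs Ob p q Y X = (\<Sum>\<mu>\<in>UNIV. \<Sum>\<phi>\<in>vars (Y \<mu>). \<Sum>\<psi>\<in>vars X.
     place p (pd \<phi> (Y \<mu>)) * place q (pd \<psi> X) * op_apply p q (Ob \<mu> \<phi> \<psi>))"

definition obs_delta :: "two_point \<Rightarrow> pt \<Rightarrow> pt \<Rightarrow> (4 \<Rightarrow> wick) \<Rightarrow> wick \<Rightarrow> npt" where
  "obs_delta Ob = obs (\<lambda>\<mu> \<phi> \<psi>. delta_part (Ob \<mu> \<phi> \<psi>))"

definition obs_string :: "two_point \<Rightarrow> pt \<Rightarrow> pt \<Rightarrow> (4 \<Rightarrow> wick) \<Rightarrow> wick \<Rightarrow> npt" where
  "obs_string Ob = obs (\<lambda>\<mu> \<phi> \<psi>. string_part (Ob \<mu> \<phi> \<psi>))"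


section \<open>The third-order obstruction\<close>

text \<open>\<open>w\<^sub>2(x,x')\<close>.\<close>
definition w2 :: "3 \<Rightarrow> npt" where
  "w2 a = (\<Sum>\<nu>\<in>UNIV. place x1 (ibr Wf (low Af \<nu>) a) * Var (Del x0 x1 {#Iop \<nu>#}))"

text \<open>\<open>Ow2 \<mu> a \<psi>\<close> stands for \<open>O\<^sub>\<mu>(w\<^sub>2\<^sub>,\<^sub>a(x,x'), \<psi>(x''))\<close>, which is not part of the
  table of two-point obstructions.\<close>

type_synonym w2_two_point = "4 \<Rightarrow> 3 \<Rightarrow> jet \<Rightarrow> npt"

definition obs_w2 :: "w2_two_point \<Rightarrow> 4 \<Rightarrow> 3 \<Rightarrow> wick \<Rightarrow> npt" where
  "obs_w2 Ow2 \<mu> a X = (\<Sum>\<psi>\<in>vars X. place x2 (pd \<psi> X) * Ow2 \<mu> a \<psi>)"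

text \<open>The four terms of the third-order obstruction. For \<open>Q\<^sub>2|\<^sub>\<delta> = Q2_loc \<delta>(x-x')\<close>, the
  rule \<open>\<SS> O\<^sub>Y\<^sub>\<delta>(X'') = 1/2 O\<^sub>Y(X'') \<delta>(x-x')\<close> is inserted; this is legitimate since these
  terms only enter symmetrized.\<close>

definition T_w2 ::
  "w2_two_point \<Rightarrow> real \<Rightarrow> real \<Rightarrow> real \<Rightarrow> real \<Rightarrow> real \<Rightarrow> npt" where
  "T_w2 Ow2 c c5 m mH a = (\<Sum>\<mu>\<in>UNIV. \<Sum>d\<in>UNIV.
     Rc 2 * place x0 (pd (jW d) (Q1 c c5 m \<mu>)) * obs_w2 Ow2 \<mu> d (L1 c c5 m mH a))"

definition T_Q2_string ::
  "two_point \<Rightarrow> real \<Rightarrow> real \<Rightarrow> real \<Rightarrow> real \<Rightarrow> real \<Rightarrow> real \<Rightarrow> npt" where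
  "T_Q2_string Ob c c5 cF m mH a =
     Rc (1/2) * obs_string Ob x0 x2 (Q2_loc cF) (L1 c c5 m mH a) * delta x0 x1"

definition T_Q2_delta ::
  "two_point \<Rightarrow> real \<Rightarrow> real \<Rightarrow> real \<Rightarrow> real \<Rightarrow> real \<Rightarrow> real \<Rightarrow> npt" where
  "T_Q2_delta Ob c c5 cF m mH a =
     Rc (1/2) * obs_delta Ob x0 x2 (Q2_loc cF) (L1 c c5 m mH a) * delta x0 x1"

definition O_Q1_L2_delta ::
  "two_point \<Rightarrow> real \<Rightarrow> real \<Rightarrow> real \<Rightarrow> real \<Rightarrow> real \<Rightarrow> real \<Rightarrow> real \<Rightarrow> npt" where
  "O_Q1_L2_delta Ob c c5 cF m mH a b =
     obs_delta Ob x0 x1 (Q1 c c5 m) (L2 cF m mH a b)"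

text \<open>\<open>O\<^sub>Q\<^sub>2(L\<^sub>1'')\<close>, where
  \<open>Q\<^sub>2 = 2 \<langle>\<partial>Q\<^sub>1/\<partial>w | w\<^sub>2\<rangle> + Q2_loc \<delta>(x-x')\<close>: by the Leibniz rule, the first
  part of \<open>Q\<^sub>2\<close> contributes the variation of \<open>w\<^sub>2\<close> and that of the remaining factors.\<close>

definition O_Q2_L1 ::
  "two_point \<Rightarrow> w2_two_point \<Rightarrow> real \<Rightarrow> real \<Rightarrow> real \<Rightarrow> real \<Rightarrow> real \<Rightarrow> real \<Rightarrow> npt" where
  "O_Q2_L1 Ob Ow2 c c5 cF m mH a =
     T_w2 Ow2 c c5 m mH a
   + (\<Sum>d\<in>UNIV. Rc 2 * w2 d *
        obs Ob x0 x2 (\<lambda>\<mu>. pd (jW d) (Q1 c c5 m \<mu>)) (L1 c c5 m mH a))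
   + Rc (1/2) * obs Ob x0 x2 (Q2_loc cF) (L1 c c5 m mH a) * delta x0 x1"

definition O3 ::
  "two_point \<Rightarrow> w2_two_point \<Rightarrow>
   real \<Rightarrow> real \<Rightarrow> real \<Rightarrow> real \<Rightarrow> real \<Rightarrow> real \<Rightarrow> real \<Rightarrow> npt" where
  "O3 Ob Ow2 c c5 cF m mH a b =
     Rc 3 * symm (O_Q2_L1 Ob Ow2 c c5 cF m mH a
       + obs Ob x0 x1 (Q1 c c5 m) (L2 cF m mH a b) * delta x1 x2)"

text \<open>\<open>\<delta>\<^sub>c L\<^sub>3 \<i>\<delta>(x,x',x'') - \<i> \<SS> \<partial>\<^sub>\<mu> Q\<^sub>3\<^sup>\<mu>(x;x',x'')\<close>\<close>

definition resolution :: "wick \<Rightarrow> (4 \<Rightarrow> npt) \<Rightarrow> npt" where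
  "resolution L3 Q3 =
     place x0 (string_var L3) * (Const \<i> * (delta x0 x1 * delta x0 x2))
     - Const \<i> * symm (divN x0 Q3)"

end

theory Submission
  imports Defs
begin

text \<open>
  The obstruction map is a derivation in each of its two arguments, so that it can be evaluated by
  the Leibniz rule from its values on the fields. Since the local two-point obstructions contain no
  derivatives of delta functions, all factors can be moved to the same point.

  The contribution of \<open>Q\<^sub>2\<close> on \<open>L\<^sub>1\<close> varies the derivative of \<open>L\<^sub>2\<^sub>,\<^sub>s\<^sub>e\<^sub>l\<^sub>f\<close> with respect to \<open>A\<^sub>\<mu>\<close> by a
  multiple of \<open>\<delta>A\<^sub>\<nu> = i[A\<^sub>\<mu>, A\<^sub>\<nu>]\<close> and vanishes by the invariance of the inner product. The
  contribution of \<open>Q\<^sub>1\<close> on \<open>L\<^sub>2\<^sub>,\<^sub>s\<^sub>e\<^sub>l\<^sub>f\<close> is an infinitesimal gauge transformation of \<open>A\<close>, under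
  which \<open>L\<^sub>2\<^sub>,\<^sub>s\<^sub>e\<^sub>l\<^sub>f\<close> is invariant. What remains is
  \<open>\<langle>w|\<phi>\<rangle> (\<alpha> H\<^sup>3 + \<beta> \<langle>\<phi>|\<phi>\<rangle> H) i\<delta>\<close>, where \<open>\<alpha> = \<beta> = 0\<close> is equivalent to the stated values
  of \<open>a\<close> and \<open>b\<close>.

  That this expression does not vanish otherwise, although the fields are subject to field equations
  and delta functions can be integrated by parts, is detected by a linear functional: evaluate the
  fields on exponential solutions, and take the Fourier transform at a point where all string
  integrations are regular. Derivatives act on this functional as scalars, so it annihilates the
  ideal of vanishing expressions as soon as it annihilates the multiples of the generators.
\<close>

section \<open>Derivations of the polynomial algebra\<close>

lemma Const_0 [simp]: "Const 0 = 0"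
  by (simp add: Const_def)

lemma Const_1 [simp]: "Const 1 = 1"
  by (simp add: Const_def)

lemma Const_add: "Const (x + y) = Const x + Const y"
  by (simp add: Const_def single_add)

lemma Const_uminus: "Const (- x) = - Const x"
  by (simp add: Const_def single_uminus)

lemma Const_diff: "Const (x - y) = Const x - Const y"
  by (simp add: Const_def single_diff)

lemma Const_mult: "Const (x * y) = Const x * Const y"
  by (simp add: Const_def mult_single)

section \<open>Sums over monomials and induction principles for polynomials\<close>

lemma sum_keys_add:
  assumes "\<And>k. F k 0 = 0" "\<And>k x y. F k (x + y) = F k x + F k y"
  shows "(\<Sum>k\<in>Poly_Mapping.keys (p + q). F k (Poly_Mapping.lookup (p + q) k))
    = (\<Sum>k\<in>Poly_Mapping.keys p. F k (Poly_Mapping.lookup p k))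
    + (\<Sum>k\<in>Poly_Mapping.keys q. F k (Poly_Mapping.lookup q k))"
  using assms by (intro setsum_keys_plus_distrib) auto

lemma sum_keys_single:
  assumes "F k 0 = 0"
  shows "(\<Sum>l\<in>Poly_Mapping.keys (Poly_Mapping.single k c).
    F l (Poly_Mapping.lookup (Poly_Mapping.single k c) l)) = F k c"
  using assms by simp

lemma poly_mapping_single_add_induct [case_names single add]:
  fixes p :: "'k \<Rightarrow>\<^sub>0 'b::comm_monoid_add"
  assumes "\<And>k c. P (Poly_Mapping.single k c)" "\<And>p q. P p \<Longrightarrow> P q \<Longrightarrow> P (p + q)"
  shows "P p"
proof -
  have P0: "P 0"
    using assms(1)[of _ 0] by simp
  have "P (\<Sum>k\<in>S. Poly_Mapping.single k (Poly_Mapping.lookup p k))" for S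
    by (induction S rule: infinite_finite_induct) (auto intro: assms P0)
  moreover have "p = (\<Sum>k\<in>Poly_Mapping.keys p. Poly_Mapping.single k (Poly_Mapping.lookup p k))"
    by (rule poly_mapping_eqI)
      (auto simp: lookup_sum lookup_single when_def sum.delta in_keys_iff)
  ultimately show ?thesis
    by metis
qed

lemma monomial_induct [case_names zero add]:
  fixes k :: "'v \<Rightarrow>\<^sub>0 nat"
  assumes "P 0" "\<And>v k. P k \<Longrightarrow> P (Poly_Mapping.single v 1 + k)"
  shows "P k"
proof (induction k rule: poly_mapping_single_add_induct)
  have *: "P k \<Longrightarrow> P (Poly_Mapping.single v c + k)" for v c k
  proof (induction c)
    case (Suc c)
    have "Poly_Mapping.single v (Suc c) + k
      = Poly_Mapping.single v 1 + (Poly_Mapping.single v c + k)"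
      by (simp add: single_add [symmetric] add.assoc [symmetric])
    then show ?case
      using assms(2) Suc by metis
  qed simp
  {
    case (single v c)
    show ?case
      using *[OF assms(1), of v c] by simp
  next
    case (add p q)
    have "P k \<Longrightarrow> P (p + k)" for p k
    proof (induction p arbitrary: k rule: poly_mapping_single_add_induct)
      case (add p q)
      then show ?case
        by (simp add: add.assoc)
    qed (rule *)
    then show ?case
      using add by blast
  }
qed

text \<open>Every monomial is a constant times a product of variables. Linear maps that are
  multiplicative or obey a Leibniz rule therefore need checking only for multiplication by a single
  \<open>Var v\<close>.\<close>

lemma mpoly_induct [case_names Const add Var]:
  assumes "\<And>z. P (Const z)" "\<And>p q. P p \<Longrightarrow> P q \<Longrightarrow> P (p + q)" "\<And>v p. P p \<Longrightarrow> P (Var v * p)"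
  shows "P p"
proof (induction p rule: poly_mapping_single_add_induct)
  case (single k c)
  show ?case
  proof (induction k rule: monomial_induct)
    case zero
    then show ?case
      using assms(1) by (simp add: Const_def)
  next
    case (add v k)
    have "Poly_Mapping.single (Poly_Mapping.single v 1 + k) c = Var v * Poly_Mapping.single k c"
      by (simp add: Var_def mult_single)
    then show ?case
      using add assms(3) by simp
  qed
qed (use assms in blast)

section \<open>Partial derivatives and the variables that occur\<close>

lemma pd_add: "pd v (p + q) = pd v p + pd v q"
  unfolding pd_def by (rule sum_keys_add) (simp_all add: single_add algebra_simps)

lemma pd_single: "pd v (Poly_Mapping.single k c)
    = Poly_Mapping.single (k - Poly_Mapping.single v 1) (of_nat (Poly_Mapping.lookup k v) * c)"
  unfolding pd_def by (rule sum_keys_single) simp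

lemma pd_Const [simp]: "pd v (Const z) = 0"
  by (simp add: Const_def pd_single)

lemma pd_Var: "pd v (Var w) = (if v = w then 1 else 0)"
  by (simp add: Var_def pd_single lookup_single when_def)

lemma pd_single_mult:
  fixes k l :: "'v \<Rightarrow>\<^sub>0 nat"
  shows "pd v (Poly_Mapping.single k x * Poly_Mapping.single l y)
    = pd v (Poly_Mapping.single k x) * Poly_Mapping.single l y
      + Poly_Mapping.single k x * pd v (Poly_Mapping.single l y)"
proof -
  \<comment> \<open>Subtraction of exponents is truncated: the exponent of \<open>v\<close> in
    \<open>k + l\<close> can be lowered inside \<open>k\<close> only if \<open>v\<close> occurs
    there. Otherwise the coefficient \<open>of_nat 0\<close> removes the term.\<close>
  have sub: "k + l - Poly_Mapping.single v 1 = (k - Poly_Mapping.single v 1) + l"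
    if "Poly_Mapping.lookup k v \<noteq> 0" for k l :: "'v \<Rightarrow>\<^sub>0 nat"
    using that by (intro poly_mapping_eqI) (auto simp: lookup_add lookup_minus lookup_single
        when_def)
  have subl: "k + l - Poly_Mapping.single v 1 = k + (l - Poly_Mapping.single v 1)"
    if "Poly_Mapping.lookup l v \<noteq> 0"
    using sub[OF that, of k] by (simp add: add.commute)
  show ?thesis
  proof (cases "Poly_Mapping.lookup k v = 0"; cases "Poly_Mapping.lookup l v = 0")
    assume "Poly_Mapping.lookup k v \<noteq> 0" "Poly_Mapping.lookup l v \<noteq> 0"
    then have "k - Poly_Mapping.single v 1 + l = k + l - Poly_Mapping.single v 1"
      "k + (l - Poly_Mapping.single v 1) = k + l - Poly_Mapping.single v 1"
      using sub[of k l] subl by simp_all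
    then show ?thesis
      by (simp add: pd_single mult_single lookup_add single_add[symmetric] algebra_simps
          del: One_nat_def)
  next
    assume "Poly_Mapping.lookup k v \<noteq> 0" "Poly_Mapping.lookup l v = 0"
    then show ?thesis
      by (simp add: pd_single mult_single lookup_add sub algebra_simps del: One_nat_def)
  next
    assume "Poly_Mapping.lookup k v = 0" "Poly_Mapping.lookup l v \<noteq> 0"
    then show ?thesis
      by (simp add: pd_single mult_single lookup_add subl algebra_simps del: One_nat_def)
  qed (simp add: pd_single mult_single lookup_add)
qed

lemma pd_mult: "pd v (p * q) = pd v p * q + p * pd v q"
proof (induction p rule: poly_mapping_single_add_induct)
  case (single k x)
  show ?case
  proof (induction q rule: poly_mapping_single_add_induct)
    case (single l y)
    then show ?case
      by (rule pd_single_mult)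
  qed (simp add: pd_add algebra_simps)
qed (simp add: pd_add algebra_simps)

lemma vars_Const [simp]: "vars (Const z) = {}"
  by (auto simp: vars_def Const_def)

lemma vars_Var [simp]: "vars (Var v) = {v}"
  by (auto simp: vars_def Var_def)

lemma vars_add: "vars (p + q) \<subseteq> vars p \<union> vars q"
  unfolding vars_def using keys_add[of p q] by fastforce

lemma vars_mult: "vars (p * q) \<subseteq> vars p \<union> vars q"
proof
  fix v
  assume "v \<in> vars (p * q)"
  then obtain k where k: "k \<in> Poly_Mapping.keys (p * q)" "v \<in> Poly_Mapping.keys k"
    by (auto simp: vars_def)
  then obtain k1 k2 where "k = k1 + k2" "k1 \<in> Poly_Mapping.keys p" "k2 \<in> Poly_Mapping.keys q"
    using keys_mult[of p q] by blast
  then show "v \<in> vars p \<union> vars q"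
    using k(2) keys_add[of k1 k2] by (auto simp: vars_def)
qed

lemma finite_vars [simp]: "finite (vars p)"
  by (simp add: vars_def)

lemma pd_not_in_vars: "v \<notin> vars p \<Longrightarrow> pd v p = 0"
  unfolding pd_def vars_def by (rule sum.neutral) (auto simp: in_keys_iff)

section \<open>Substitution as an algebra homomorphism\<close>

lemma poly_subst_add: "poly_subst s (p + q) = poly_subst s p + poly_subst s q"
  unfolding poly_subst_def by (rule sum_keys_add) (simp_all add: Const_add algebra_simps)

lemma poly_subst_single: "poly_subst s (Poly_Mapping.single k c)
    = Const c * (\<Prod>v\<in>Poly_Mapping.keys k. s v ^ Poly_Mapping.lookup k v)"
  unfolding poly_subst_def by (rule sum_keys_single) simp

lemma poly_subst_Const [simp]: "poly_subst s (Const z) = Const z"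
  by (simp add: Const_def [of z] poly_subst_single)

lemma poly_subst_Var [simp]: "poly_subst s (Var v) = s v"
  by (simp add: Var_def poly_subst_single)

lemma poly_subst_Var_mult: "poly_subst s (Var v * p) = s v * poly_subst s p"
proof (induction p rule: poly_mapping_single_add_induct)
  case (single k c)
  let ?e = "Poly_Mapping.single v (1 :: nat)"
  let ?S = "insert v (Poly_Mapping.keys k)"
  \<comment> \<open>Absent variables contribute zeroth powers, so all products can be taken over the
    common index set \<open>?S\<close>.\<close>
  have sub: "(\<Prod>u\<in>Poly_Mapping.keys l. s u ^ Poly_Mapping.lookup l u)
      = (\<Prod>u\<in>?S. s u ^ Poly_Mapping.lookup l u)" if "Poly_Mapping.keys l \<subseteq> ?S" for l
    by (rule prod.mono_neutral_left) (use that in \<open>auto simp: in_keys_iff\<close>)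
  have "poly_subst s (Var v * Poly_Mapping.single k c)
      = Const c * (\<Prod>u\<in>?S. s u ^ Poly_Mapping.lookup (?e + k) u)"
    using keys_add[of ?e k] by (simp add: Var_def mult_single poly_subst_single sub subset_insertI2)
  also have "(\<Prod>u\<in>?S. s u ^ Poly_Mapping.lookup (?e + k) u)
      = (\<Prod>u\<in>?S. s u ^ Poly_Mapping.lookup ?e u) * (\<Prod>u\<in>?S. s u ^ Poly_Mapping.lookup k u)"
    by (simp only: lookup_add power_add prod.distrib)
  also have "(\<Prod>u\<in>?S. s u ^ Poly_Mapping.lookup ?e u) = s v"
    using sub[of ?e] by simp
  also have "(\<Prod>u\<in>?S. s u ^ Poly_Mapping.lookup k u)
      = (\<Prod>u\<in>Poly_Mapping.keys k. s u ^ Poly_Mapping.lookup k u)"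
    using sub[of k] by (simp add: subset_insertI)
  finally show ?case
    by (simp add: poly_subst_single ac_simps)
qed (simp add: poly_subst_add algebra_simps)

lemma Const_mult_single: "Const z * Poly_Mapping.single k c = Poly_Mapping.single k (z * c)"
  by (simp add: Const_def mult_single)

lemma poly_subst_mult: "poly_subst s (p * q) = poly_subst s p * poly_subst s q"
proof (induction p rule: mpoly_induct)
  case (Const z)
  show ?case
  proof (induction q rule: poly_mapping_single_add_induct)
    case (single k c)
    then show ?case
      by (simp add: Const_mult_single poly_subst_single Const_mult ac_simps)
  qed (simp add: poly_subst_add algebra_simps)
next
  case (Var v p)
  then show ?case
    by (simp add: poly_subst_Var_mult mult.assoc)
qed (simp add: poly_subst_add algebra_simps)

lemma poly_subst_0 [simp]: "poly_subst s 0 = 0"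
  using poly_subst_Const[of s 0] by simp

lemma poly_subst_1 [simp]: "poly_subst s 1 = 1"
  using poly_subst_Const[of s 1] by simp

lemma poly_subst_uminus: "poly_subst s (- p) = - poly_subst s p"
  using poly_subst_add[of s p "- p"] by (simp add: eq_neg_iff_add_eq_0 add.commute)

lemma poly_subst_diff: "poly_subst s (p - q) = poly_subst s p - poly_subst s q"
  using poly_subst_add[of s p "- q"] by (simp add: poly_subst_uminus)

lemma poly_subst_sum: "poly_subst s (\<Sum>i\<in>A. f i) = (\<Sum>i\<in>A. poly_subst s (f i))"
  by (induction A rule: infinite_finite_induct) (simp_all add: poly_subst_add)

lemma poly_subst_power: "poly_subst s (p ^ n) = poly_subst s p ^ n"
  by (induction n) (simp_all add: poly_subst_mult)

lemmas poly_subst_simps = poly_subst_add poly_subst_mult poly_subst_uminus poly_subst_diff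
  poly_subst_sum poly_subst_power

lemma poly_subst_Var_id [simp]: "poly_subst Var p = p"
  by (induction p rule: mpoly_induct) (simp_all add: poly_subst_add poly_subst_mult)

text \<open>A derivation along the homomorphism \<open>poly_subst s\<close>. Both \<open>derivation\<close> and, in each of its
  two arguments, the obstruction map are of this form.\<close>

definition leib :: "('v \<Rightarrow> 'u mpoly) \<Rightarrow> ('v \<Rightarrow> 'u mpoly) \<Rightarrow> 'v mpoly \<Rightarrow> 'u mpoly" where
  "leib s G p = (\<Sum>v\<in>vars p. poly_subst s (pd v p) * G v)"

text \<open>Derivatives with respect to absent variables vanish. This lets sums over the variables
  of different polynomials be compared over one common set.\<close>

lemma leib_superset:
  assumes "finite S" "vars p \<subseteq> S"
  shows "leib s G p = (\<Sum>v\<in>S. poly_subst s (pd v p) * G v)"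
  unfolding leib_def
  by (rule sum.mono_neutral_left) (use assms in \<open>auto simp: pd_not_in_vars\<close>)

lemma leib_add: "leib s G (p + q) = leib s G p + leib s G q"
proof -
  let ?S = "vars p \<union> vars q"
  have "leib s G (p + q) = (\<Sum>v\<in>?S. poly_subst s (pd v (p + q)) * G v)"
    using vars_add[of p q] by (intro leib_superset) auto
  also have "\<dots> = leib s G p + leib s G q"
    by (simp add: pd_add poly_subst_add distrib_right sum.distrib leib_superset[of ?S])
  finally show ?thesis .
qed

lemma leib_mult: "leib s G (p * q) = leib s G p * poly_subst s q + poly_subst s p * leib s G q"
proof -
  let ?S = "vars p \<union> vars q"
  have "leib s G (p * q) = (\<Sum>v\<in>?S. poly_subst s (pd v (p * q)) * G v)"
    using vars_mult[of p q] by (intro leib_superset) auto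
  also have "\<dots> = leib s G p * poly_subst s q + poly_subst s p * leib s G q"
    by (simp add: leib_superset[of ?S] pd_mult poly_subst_add poly_subst_mult sum.distrib
        sum_distrib_left sum_distrib_right algebra_simps)
  finally show ?thesis .
qed

lemma leib_Const [simp]: "leib s G (Const z) = 0"
  by (simp add: leib_def)

lemma leib_Var [simp]: "leib s G (Var v) = G v"
  by (simp add: leib_def pd_Var)

lemma leib_0 [simp]: "leib s G 0 = 0"
  using leib_Const[of s G 0] by simp

lemma leib_1 [simp]: "leib s G 1 = 0"
  using leib_Const[of s G 1] by simp

lemma leib_uminus: "leib s G (- p) = - leib s G p"
  using leib_add[of s G p "- p"] by (simp add: eq_neg_iff_add_eq_0 add.commute)

lemma leib_diff: "leib s G (p - q) = leib s G p - leib s G q"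
  using leib_add[of s G p "- q"] by (simp add: leib_uminus)

lemma leib_sum: "leib s G (\<Sum>i\<in>A. f i) = (\<Sum>i\<in>A. leib s G (f i))"
  by (induction A rule: infinite_finite_induct) (simp_all add: leib_add)

lemma leib_power: "leib s G (p ^ n) = of_nat n * poly_subst s p ^ (n - 1) * leib s G p"
proof (induction n)
  case (Suc n)
  then show ?case
    by (cases n) (simp_all add: leib_mult poly_subst_simps algebra_simps)
qed simp

lemmas leib_simps = leib_add leib_mult leib_uminus leib_diff leib_sum leib_power

lemma leib_zero [simp]: "leib s (\<lambda>v. 0) p = 0"
  by (simp add: leib_def)

lemma leib_sum_right: "(\<Sum>i\<in>A. leib s (G i) p) = leib s (\<lambda>v. \<Sum>i\<in>A. G i v) p"
  unfolding leib_def by (subst sum.swap) (simp add: sum_distrib_left)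

lemma leib_scale: "leib s (\<lambda>v. z * G v) p = z * leib s G p"
  by (simp add: leib_def sum_distrib_left ac_simps)

lemma poly_subst_leib: "poly_subst s (leib Var G p) = leib s (\<lambda>v. poly_subst s (G v)) p"
  by (simp add: leib_def poly_subst_simps)

lemma derivation_eq_leib: "derivation = leib Var"
  by (intro ext) (simp add: derivation_def leib_def)

text \<open>A partial derivative is the derivation with value 1 on one variable and 0 on the others;
  this makes the Leibniz rules available for the derivative inside \<open>Q2_loc\<close>.\<close>

lemma pd_eq_leib: "pd v p = leib Var (\<lambda>w. if w = v then 1 else 0) p"
proof -
  have "leib Var (\<lambda>w. if w = v then 1 else 0) p
      = (\<Sum>w\<in>insert v (vars p). pd w p * (if w = v then 1 else 0))"
    by (subst leib_superset[of "insert v (vars p)"]) auto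
  also have "\<dots> = (\<Sum>w\<in>insert v (vars p). if w = v then pd w p else 0)"
    by (rule sum.cong) auto
  also have "\<dots> = pd v p"
    by (subst sum.delta) simp_all
  finally show ?thesis ..
qed

section \<open>The ideal of vanishing expressions\<close>

lemma poly_subst_poly_subst: "poly_subst s (poly_subst t p) = poly_subst (\<lambda>v. poly_subst s (t v)) p"
  by (induction p rule: mpoly_induct) (simp_all add: poly_subst_simps)

lemma place_Var [simp]: "place p (Var j) = Var (At p j)"
  by (simp add: place_def)

lemma place_Const [simp]: "place p (Const z) = Const z"
  by (simp add: place_def)

lemma place_0 [simp]: "place p 0 = 0"
  by (simp add: place_def)

lemma place_1 [simp]: "place p 1 = 1"
  by (simp add: place_def)

lemmas place_simps = poly_subst_simps[of "\<lambda>j. Var (At p j)" for p, folded place_def]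

text \<open>Zero is not among the generators; it arises as 0 times one of them.\<close>

lemma null_ideal_0 [simp]: "0 \<in> null_ideal c c5 m mH"
  using null_ideal.mult[OF null_ideal.field_eq[OF field_eqs.div_J], of 0] by simp

lemma null_ideal_uminus: "e \<in> null_ideal c c5 m mH \<Longrightarrow> - e \<in> null_ideal c c5 m mH"
  using null_ideal.mult[of e c c5 m mH "- 1"] by simp

lemma null_ideal_sum:
  "(\<And>i. i \<in> A \<Longrightarrow> f i \<in> null_ideal c c5 m mH) \<Longrightarrow> (\<Sum>i\<in>A. f i) \<in> null_ideal c c5 m mH"
  by (induction A rule: infinite_finite_induct) (auto intro: null_ideal.add)

lemma eqv_refl [simp]: "eqv c c5 m mH e e"
  by (simp add: eqv_def)

lemma eqv_sym: "eqv c c5 m mH e f \<Longrightarrow> eqv c c5 m mH f e"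
  unfolding eqv_def using null_ideal_uminus by fastforce

lemma eqv_trans [trans]: "eqv c c5 m mH e f \<Longrightarrow> eqv c c5 m mH f h \<Longrightarrow> eqv c c5 m mH e h"
  unfolding eqv_def using null_ideal.add[of "e - f" c c5 m mH "f - h"] by simp

lemma eqv_add:
  "eqv c c5 m mH e f \<Longrightarrow> eqv c c5 m mH e' f' \<Longrightarrow> eqv c c5 m mH (e + e') (f + f')"
  unfolding eqv_def using null_ideal.add[of "e - f" c c5 m mH "e' - f'"] by
      (simp add: algebra_simps)

lemma eqv_mult_left: "eqv c c5 m mH e f \<Longrightarrow> eqv c c5 m mH (h * e) (h * f)"
  unfolding eqv_def using null_ideal.mult[of "e - f" c c5 m mH h] by (simp add: algebra_simps)

lemma eqv_mult_right: "eqv c c5 m mH e f \<Longrightarrow> eqv c c5 m mH (e * h) (f * h)"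
  using eqv_mult_left[of c c5 m mH e f h] by (simp add: mult.commute)

lemma eqv_sum:
  "(\<And>i. i \<in> A \<Longrightarrow> eqv c c5 m mH (f i) (h i)) \<Longrightarrow> eqv c c5 m mH (\<Sum>i\<in>A. f i) (\<Sum>i\<in>A. h i)"
  unfolding eqv_def sum_subtractf[symmetric] by (rule null_ideal_sum)

text \<open>The generator \<open>localize\<close> moves one field across the delta function;
  induction over products moves a whole Wick polynomial.\<close>

lemma place_delta:
  assumes "p \<noteq> q"
  shows "eqv c c5 m mH (place q P * delta p q) (place p P * delta p q)"
proof (induction P rule: mpoly_induct)
  case (add P Q)
  then show ?case
    by (simp add: place_simps distrib_right eqv_add)
next
  case (Var v P)
  have "eqv c c5 m mH (place q (Var v * P) * delta p q) (place p P * (Var (At q v) * delta p q))"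
    using eqv_mult_left[OF Var, of "Var (At q v)"] by (simp add: place_simps ac_simps)
  also have "eqv c c5 m mH (place p P * (Var (At q v) * delta p q)) (place p P * (Var (At p v)
      * delta p q))"
    using null_ideal.localize[OF assms]
    by (intro eqv_mult_left [OF eqv_sym])
      (simp add: eqv_def left_diff_distrib)
  finally show ?case
    by (simp add: place_simps ac_simps)
qed simp

text \<open>Replacing a factor at \<open>p\<close> by an expression at \<open>q\<close> times
  \<delta>(p-q) amounts to an ordinary derivation at \<open>p\<close>. This turns two-point
  obstructions into one-point algebra.\<close>

lemma leib_delta:
  assumes "p \<noteq> q"
  shows "eqv c c5 m mH (leib (\<lambda>j. Var (At p j)) (\<lambda>j. place q (R j) * (z * delta p q)) Y)
    (place p (derivation R Y) * (z * delta p q))"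
proof -
  have "eqv c c5 m mH (\<Sum>j\<in>vars Y. (z * place p (pd j Y)) * (place q (R j) * delta p q))
      (\<Sum>j\<in>vars Y. (z * place p (pd j Y)) * (place p (R j) * delta p q))"
    by (intro eqv_sum eqv_mult_left place_delta assms)
  then show ?thesis
    by (simp add: leib_def derivation_def place_simps sum_distrib_left sum_distrib_right
        place_def [symmetric] ac_simps)
qed

section \<open>Permutations of the points preserve the ideal\<close>

lemma permute_pts_dN:
  assumes "inj \<pi>"
  shows "permute_pts \<pi> (dN p \<kappa> e) = dN (\<pi> p) \<kappa> (permute_pts \<pi> e)"
proof (induction e rule: mpoly_induct)
  case (Var v e)
  have eq: "\<pi> p = \<pi> q \<longleftrightarrow> p = q" for q
    using assms by (auto dest: injD)
  show ?case
    using Var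
    by (cases v) (auto simp: permute_pts_def dN_def derivation_eq_leib leib_simps poly_subst_simps
        eq)
qed (simp_all add: permute_pts_def dN_def derivation_eq_leib leib_simps poly_subst_simps)

text \<open>Renaming points maps each kind of generator to itself; injectivity keeps distinct points
  distinct, as the generators with delta functions require.\<close>

lemma permute_pts_null_ideal:
  assumes "e \<in> null_ideal c c5 m mH" "inj \<pi>"
  shows "permute_pts \<pi> e \<in> null_ideal c c5 m mH"
  using assms(1)
proof induction
  case (field_eq r p)
  have "permute_pts \<pi> (place p r) = place (\<pi> p) r"
    by (simp add: permute_pts_def place_def poly_subst_poly_subst)
  then show ?case
    using null_ideal.field_eq[OF field_eq] by simp
next
  case (reflect p q D)
  have "\<pi> p \<noteq> \<pi> q"
    using reflect assms by (auto dest: injD)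
  then show ?case
    using null_ideal.reflect[of "\<pi> p" "\<pi> q" D c c5 m mH] by
        (simp add: permute_pts_def poly_subst_simps)
next
  case (localize p q j)
  have "\<pi> p \<noteq> \<pi> q"
    using localize assms by (auto dest: injD)
  then show ?case
    using null_ideal.localize[of "\<pi> p" "\<pi> q" j c c5 m mH]
    by (simp add: permute_pts_def poly_subst_simps delta_def)
next
  case (localize_Del p q r D)
  have "\<pi> p \<noteq> \<pi> q" "\<pi> p \<noteq> \<pi> r" "\<pi> q \<noteq> \<pi> r"
    using localize_Del assms by (auto dest: injD)
  then show ?case
    using null_ideal.localize_Del[of "\<pi> p" "\<pi> q" "\<pi> r" D c c5 m mH]
    by (simp add: permute_pts_def poly_subst_simps delta_def)
next
  case (string p q D)
  have "\<pi> p \<noteq> \<pi> q"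
    using string assms by (auto dest: injD)
  then show ?case
    using null_ideal.string[of "\<pi> p" "\<pi> q" D c c5 m mH]
    by (simp add: permute_pts_def poly_subst_simps)
next
  case (string' p q D)
  have "\<pi> p \<noteq> \<pi> q"
    using string' assms by (auto dest: injD)
  then show ?case
    using null_ideal.string'[of "\<pi> p" "\<pi> q" D c c5 m mH]
    by (simp add: permute_pts_def poly_subst_simps)
next
  case (add e f)
  then show ?case
    by (simp add: permute_pts_def poly_subst_add null_ideal.add)
next
  case (mult e f)
  then show ?case
    by (simp add: permute_pts_def poly_subst_mult null_ideal.mult)
next
  case (deriv e p \<kappa>)
  then show ?case
    by (simp add: permute_pts_dN assms(2) null_ideal.deriv)
qed

lemma symm_null_ideal: "e \<in> null_ideal c c5 m mH \<Longrightarrow> symm e \<in> null_ideal c c5 m mH"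
  unfolding symm_def
  by (intro null_ideal.mult null_ideal_sum permute_pts_null_ideal) (auto dest: bij_is_inj)

lemma symm_add: "symm (e + f) = symm e + symm f"
  by (simp add: symm_def permute_pts_def poly_subst_add sum.distrib distrib_left)

lemma symm_0 [simp]: "symm 0 = 0"
  by (simp add: symm_def permute_pts_def)

lemma dN_0 [simp]: "dN p \<kappa> 0 = 0"
  by (simp add: dN_def derivation_eq_leib)

lemma divN_0 [simp]: "divN p (\<lambda>\<mu>. 0) = 0"
  by (simp add: divN_def)

lemma divN_add: "divN p (\<lambda>\<mu>. V \<mu> + W \<mu>) = divN p V + divN p W"
  by (simp add: divN_def dN_def derivation_eq_leib leib_add distrib_left sum.distrib)

lemma resolution_0 [simp]: "resolution 0 (\<lambda>\<mu>. 0) = 0"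
  by (simp add: resolution_def string_var_def derivation_eq_leib)

section \<open>Equality up to total derivatives\<close>

lemma eq_der_of_eqv: "eqv c c5 m mH e f \<Longrightarrow> eq_der c c5 m mH e f"
  unfolding eq_der_def by (rule exI[of _ "\<lambda>p \<mu>. 0"]) simp

lemma eq_der_add:
  assumes "eq_der c c5 m mH e f" "eq_der c c5 m mH e' f'"
  shows "eq_der c c5 m mH (e + e') (f + f')"
proof -
  obtain V W where "eqv c c5 m mH e (f + (\<Sum>p\<in>{x0, x1, x2}. divN p (V p)))"
    "eqv c c5 m mH e' (f' + (\<Sum>p\<in>{x0, x1, x2}. divN p (W p)))"
    using assms unfolding eq_der_def by blast
  from eqv_add[OF this]
  have "eqv c c5 m mH (e + e')
    (f + f' + (\<Sum>p\<in>{x0, x1, x2}. divN p (\<lambda>\<mu>. V p \<mu> + W p \<mu>)))"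
    by (simp add: divN_add algebra_simps)
  then show ?thesis
    unfolding eq_der_def by (intro exI[of _ "\<lambda>p \<mu>. V p \<mu> + W p \<mu>"])
qed

lemma eq_der_trans:
  assumes "eq_der c c5 m mH e f" "eq_der c c5 m mH f h"
  shows "eq_der c c5 m mH e h"
proof -
  \<comment> \<open>The summand \<open>f\<close> occurs on both sides and cancels in the difference
    that must lie in the ideal.\<close>
  have "eq_der c c5 m mH (e + f) (f + h)"
    using eq_der_add[OF assms] .
  then show ?thesis
    by (simp add: eq_der_def eqv_def algebra_simps)
qed

section \<open>A functional that annihilates the ideal\<close>

text \<open>The weights \<open>w\<close> are multiplicative, but the factor \<open>\<xi>\<close> is
  an arbitrary function of the total grade, so the functional need not be a homomorphism. The inner
  sum over \<open>i\<close> is the multiple of \<open>gr v\<close> by the exponent of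
  \<open>v\<close>.\<close>

definition graded_eval ::
  "('v \<Rightarrow> complex) \<Rightarrow> ('v \<Rightarrow> 'g::comm_monoid_add) \<Rightarrow> ('g \<Rightarrow> complex) \<Rightarrow> 'v mpoly \<Rightarrow> complex" where
  "graded_eval w gr \<xi> p = (\<Sum>k\<in>Poly_Mapping.keys p. Poly_Mapping.lookup p k *
     ((\<Prod>v\<in>Poly_Mapping.keys k. w v ^ Poly_Mapping.lookup k v) *
      \<xi> (\<Sum>v\<in>Poly_Mapping.keys k. \<Sum>i<Poly_Mapping.lookup k v. gr v)))"

lemma graded_eval_add: "graded_eval w gr \<xi> (p + q) = graded_eval w gr \<xi> p + graded_eval w gr \<xi> q"
  unfolding graded_eval_def by (rule sum_keys_add) (simp_all add: algebra_simps)

lemma graded_eval_single: "graded_eval w gr \<xi> (Poly_Mapping.single k z) =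
     z * ((\<Prod>v\<in>Poly_Mapping.keys k. w v ^ Poly_Mapping.lookup k v) *
      \<xi> (\<Sum>v\<in>Poly_Mapping.keys k. \<Sum>i<Poly_Mapping.lookup k v. gr v))"
  unfolding graded_eval_def by (rule sum_keys_single) simp

lemma graded_eval_Const: "graded_eval w gr \<xi> (Const z) = z * \<xi> 0"
  by (simp add: Const_def graded_eval_single)

lemma graded_eval_Const_mult: "graded_eval w gr \<xi> (Const z * p) = z * graded_eval w gr \<xi> p"
  by (induction p rule: poly_mapping_single_add_induct)
    (simp_all add: Const_mult_single graded_eval_single graded_eval_add algebra_simps)

lemma graded_eval_0 [simp]: "graded_eval w gr \<xi> 0 = 0"
  by (simp add: graded_eval_def)

lemma graded_eval_1 [simp]: "graded_eval w gr \<xi> 1 = \<xi> 0"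
  using graded_eval_Const[of w gr \<xi> 1] by simp

lemma graded_eval_uminus: "graded_eval w gr \<xi> (- p) = - graded_eval w gr \<xi> p"
  using graded_eval_add[of w gr \<xi> p "- p"] by (simp add: eq_neg_iff_add_eq_0 add.commute)

lemma graded_eval_diff: "graded_eval w gr \<xi> (p - q) = graded_eval w gr \<xi> p - graded_eval w gr \<xi> q"
  using graded_eval_add[of w gr \<xi> p "- q"] by (simp add: graded_eval_uminus)

lemma graded_eval_sum: "graded_eval w gr \<xi> (\<Sum>i\<in>A. f i) = (\<Sum>i\<in>A. graded_eval w gr \<xi> (f i))"
  by (induction A rule: infinite_finite_induct) (simp_all add: graded_eval_add)

text \<open>Splitting off a variable multiplies by its weight and translates \<open>\<xi>\<close> by
  its grade. Inductions using this rule must therefore keep \<open>\<xi>\<close> arbitrary.\<close>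

lemma graded_eval_Var_mult:
  fixes v :: 'v
  shows "graded_eval w gr \<xi> (Var v * p) = w v * graded_eval w gr (\<lambda>x. \<xi> (gr v + x)) p"
proof (induction p rule: poly_mapping_single_add_induct)
  case (single k c)
  let ?e = "Poly_Mapping.single v (1 :: nat)"
  let ?S = "insert v (Poly_Mapping.keys k)"
  have prod: "(\<Prod>u\<in>Poly_Mapping.keys l. w u ^ Poly_Mapping.lookup l u)
      = (\<Prod>u\<in>?S. w u ^ Poly_Mapping.lookup l u)" if "Poly_Mapping.keys l \<subseteq> ?S" for l :: "'v \<Rightarrow>\<^sub>0 nat"
    by (rule prod.mono_neutral_left) (use that in \<open>auto simp: in_keys_iff\<close>)
  have sum: "(\<Sum>u\<in>Poly_Mapping.keys l. \<Sum>i<Poly_Mapping.lookup l u. gr u)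
      = (\<Sum>u\<in>?S. \<Sum>i<Poly_Mapping.lookup l u. gr u)" if "Poly_Mapping.keys l \<subseteq> ?S" for l :: "'v \<Rightarrow>\<^sub>0
          nat"
    by (rule sum.mono_neutral_left) (use that in \<open>auto simp: in_keys_iff\<close>)
  have k: "Poly_Mapping.keys k \<subseteq> ?S" and e: "Poly_Mapping.keys ?e \<subseteq> ?S"
    and ek: "Poly_Mapping.keys (?e + k) \<subseteq> ?S"
    using keys_add[of ?e k] by auto
  have split: "(\<Sum>i<a + b. gr u) = (\<Sum>i<a. gr u) + (\<Sum>i<b. gr u)" for a b :: nat and u
    by (induction b) (simp_all add: ac_simps)
  have "(\<Prod>u\<in>Poly_Mapping.keys (?e + k). w u ^ Poly_Mapping.lookup (?e + k) u)
      = (\<Prod>u\<in>Poly_Mapping.keys ?e. w u ^ Poly_Mapping.lookup ?e u)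
        * (\<Prod>u\<in>Poly_Mapping.keys k. w u ^ Poly_Mapping.lookup k u)"
    unfolding prod[OF k] prod[OF e] prod[OF ek] by (simp only: lookup_add power_add prod.distrib)
  moreover have "(\<Sum>u\<in>Poly_Mapping.keys (?e + k). \<Sum>i<Poly_Mapping.lookup (?e + k) u. gr u)
      = (\<Sum>u\<in>Poly_Mapping.keys ?e. \<Sum>i<Poly_Mapping.lookup ?e u. gr u)
        + (\<Sum>u\<in>Poly_Mapping.keys k. \<Sum>i<Poly_Mapping.lookup k u. gr u)"
    unfolding sum[OF k] sum[OF e] sum[OF ek] by (simp only: lookup_add split sum.distrib)
  ultimately show ?case
    by (simp add: Var_def mult_single graded_eval_single)
qed (simp add: graded_eval_add algebra_simps)

lemma graded_eval_Var: "graded_eval w gr \<xi> (Var v) = w v * \<xi> (gr v)"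
  using graded_eval_Var_mult[of w gr \<xi> v 1] by simp

lemma graded_eval_char_add:
  "graded_eval w gr (\<lambda>x. \<xi> x + \<xi>' x) p = graded_eval w gr \<xi> p + graded_eval w gr \<xi>' p"
  by (simp add: graded_eval_def algebra_simps sum.distrib)

lemma graded_eval_char_scale: "graded_eval w gr (\<lambda>x. z * \<xi> x) p = z * graded_eval w gr \<xi> p"
  by (simp add: graded_eval_def sum_distrib_left ac_simps)

lemma graded_eval_char_0 [simp]: "graded_eval w gr (\<lambda>x. 0) p = 0"
  by (simp add: graded_eval_def)

text \<open>The invariant \<open>R\<close> holds for all grades that monomials can attain, so
  \<open>\<xi>\<close> matters only there.\<close>

lemma graded_eval_cong:
  assumes "R 0" "\<And>v x. R x \<Longrightarrow> R (gr v + x)" "\<And>x. R x \<Longrightarrow> \<xi> x = \<xi>' x"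
  shows "graded_eval w gr \<xi> p = graded_eval w gr \<xi>' p"
  using assms(3)
proof (induction p arbitrary: \<xi> \<xi>' rule: mpoly_induct)
  case (Const z)
  then show ?case
    using assms(1) by (simp add: graded_eval_Const)
next
  case (add p q)
  have "graded_eval w gr \<xi> p = graded_eval w gr \<xi>' p"
    "graded_eval w gr \<xi> q = graded_eval w gr \<xi>' q"
    using add.prems by (intro add.IH, blast)+
  then show ?case
    by (simp add: graded_eval_add)
next
  case (Var v p)
  have "graded_eval w gr (\<lambda>x. \<xi> (gr v + x)) p = graded_eval w gr (\<lambda>x. \<xi>' (gr v + x)) p"
    using Var.prems assms(2) by (intro Var.IH) blast
  then show ?case
    by (simp add: graded_eval_Var_mult)
qed

lemmas graded_eval_simps = graded_eval_add graded_eval_uminus graded_eval_diff graded_eval_sum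
  graded_eval_Const_mult graded_eval_Var_mult

text \<open>The fields are evaluated on a classical solution that depends on time only:
  \<open>\<phi>\<^sub>1 = w\<^sub>1 = e\<^sup>i\<^sup>m\<^sup>t\<close>, \<open>H = h e\<^sup>i\<^sup>M\<^sup>t\<close> with \<open>M\<close> the Higgs mass, \<open>A = \<partial>\<phi>\<close>, and all other
  components zero.\<close>

definition freq :: "real \<Rightarrow> real \<Rightarrow> field \<Rightarrow> real" where
  "freq m mH f = (case f of FH \<Rightarrow> mH | _ \<Rightarrow> m)"

definition ampl :: "real \<Rightarrow> complex \<Rightarrow> field \<Rightarrow> complex" where
  "ampl m h f = (case f of
      FA \<kappa> a \<Rightarrow> if \<kappa> = 0 \<and> a = 1 then \<i> * m else 0
    | FPhi a \<Rightarrow> if a = 1 then 1 else 0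
    | FW a \<Rightarrow> if a = 1 then 1 else 0
    | FH \<Rightarrow> h
    | _ \<Rightarrow> 0)"

text \<open>Only time components are kept. There
  \<open>I\<^sup>\<nu>\<partial>\<^sub>\<nu> = -1\<close> makes \<open>Iop 0\<close> minus the
  inverse of the time derivative, and \<open>Iop' 0\<close> plus this inverse; hence also the order
  -1 in \<open>op_order\<close>.\<close>

definition op_sign :: "opsym \<Rightarrow> complex" where
  "op_sign s = (case s of Dop \<kappa> \<Rightarrow> if \<kappa> = 0 then 1 else 0 | Iop \<kappa> \<Rightarrow> if \<kappa> = 0 then -1 else 0
    | Iop' \<kappa> \<Rightarrow> if \<kappa> = 0 then 1 else 0)"

definition op_order :: "opsym \<Rightarrow> int" where
  "op_order s = (case s of Dop \<kappa> \<Rightarrow> 1 | _ \<Rightarrow> -1)"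

text \<open>The sign of \<partial> on \<delta>(p-q) relative to the derivative with respect to
  \<open>x0\<close> of \<delta>(x0-x1). The value 0 discards every delta function that does not join
  \<open>x0\<close> and \<open>x1\<close>; its square serves as an indicator in
  \<open>sym_weight\<close>.\<close>

definition orient :: "pt \<Rightarrow> pt \<Rightarrow> complex" where
  "orient p q = (if p = x0 \<and> q = x1 then 1 else if p = x1 \<and> q = x0 then -1 else 0)"

definition sym_weight :: "real \<Rightarrow> real \<Rightarrow> complex \<Rightarrow> sym \<Rightarrow> complex" where
  "sym_weight m mH h s = (case s of
      At p j \<Rightarrow> (case j of Jet D f \<Rightarrow> if p = x2 then 0 else
        ampl m h f * (\<Prod>\<kappa>\<in>#D. if \<kappa> = 0 then \<i> * freq m mH f else 0))
    | Del p q D \<Rightarrow> (orient p q)\<^sup>2 * (\<Prod>s\<in>#D. orient p q * op_sign s))"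

text \<open>The components of the grade are the total frequencies at \<open>x0\<close> and at \<open>x1\<close>, the net number
  of derivatives of the delta functions, and the number of delta functions.\<close>

type_synonym grade = "real \<times> real \<times> int \<times> nat"

definition sym_grade :: "real \<Rightarrow> real \<Rightarrow> sym \<Rightarrow> grade" where
  "sym_grade m mH s = (case s of
      At p j \<Rightarrow> (case j of Jet D f \<Rightarrow>
        (if p = x0 then freq m mH f else 0, if p = x1 then freq m mH f else 0, 0, 0))
    | Del p q D \<Rightarrow> (0, 0, \<Sum>s\<in>#D. op_order s, 1))"

text \<open>In Fourier space, \<open>exp (i a t\<^sub>0 + i a' t\<^sub>1) \<partial>\<^sup>n \<delta>(t\<^sub>0 - t\<^sub>1)\<close> is supported at total frequency
  \<open>a + a'\<close>, where its value at \<open>k\<close> (dual to \<open>t\<^sub>0\<close>) is \<open>(k - i a)\<^sup>n\<close>. The functional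
  evaluates it at \<open>k = 1\<close>, which avoids the poles occurring for negative \<open>n\<close>, i.e., for
  string integrations.\<close>

definition fourier :: "real \<Rightarrow> grade \<Rightarrow> complex" where
  "fourier T x = (case x of (a0, a1, n, d) \<Rightarrow>
     if d = 1 \<and> a0 + a1 = T then (1 - \<i> * a0) powi n else 0)"

definition freq_at :: "pt \<Rightarrow> grade \<Rightarrow> complex" where
  "freq_at p x = (case p of x0 \<Rightarrow> fst x | x1 \<Rightarrow> fst (snd x) | x2 \<Rightarrow> 0)"

text \<open>The transpose of the derivative at \<open>p\<close>, acting on functions of the grade:
  fields contribute their total frequency at \<open>p\<close>, and each delta function raises the
  derivative order by one.\<close>

definition shift_deriv :: "pt \<Rightarrow> 4 \<Rightarrow> (grade \<Rightarrow> complex) \<Rightarrow> grade \<Rightarrow> complex" where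
  "shift_deriv p \<kappa> \<xi> x = (if \<kappa> = 0 then \<i> * freq_at p x * \<xi> x
     + (case p of x0 \<Rightarrow> 1 | x1 \<Rightarrow> -1 | x2 \<Rightarrow> 0) * of_nat (snd (snd (snd x)))
       * \<xi> (x + (0, 0, 1, 0)) else 0)"

lemma sym_weight_Dop: "sym_weight m mH h (Del q r (add_mset (Dop \<kappa>) D))
    = (if \<kappa> = 0 then orient q r else 0) * sym_weight m mH h (Del q r D)"
  by (simp add: sym_weight_def op_sign_def)

lemma sym_grade_Dop:
  "sym_grade m mH (Del q r (add_mset (Dop \<kappa>) D)) = sym_grade m mH (Del q r D) + (0, 0, 1, 0)"
  by (simp add: sym_grade_def op_order_def)

lemma graded_eval_dN:
  fixes m mH :: real and h :: complex
  defines "E \<equiv> graded_eval (sym_weight m mH h) (sym_grade m mH)"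
  shows "E \<xi> (dN p \<kappa> e) = E (shift_deriv p \<kappa> \<xi>) e"
proof (induction e arbitrary: \<xi> rule: mpoly_induct)
  case (Const z)
  have "freq_at p 0 = 0"
    by (cases p) (simp_all add: freq_at_def)
  then show ?case
    by (simp add: E_def dN_def derivation_eq_leib graded_eval_Const shift_deriv_def)
next
  case (add e f)
  then show ?case
    by (simp add: E_def dN_def derivation_eq_leib leib_add graded_eval_add)
next
  case (Var v e)
  define d where "d = (case v of
       At q j \<Rightarrow> (if p = q then Var (At q (jD \<kappa> j)) else 0)
     | Del q r D \<Rightarrow> (if p = q then Var (Del q r (add_mset (Dop \<kappa>) D)) else 0)
                  - (if p = r then Var (Del q r (add_mset (Dop \<kappa>) D)) else 0))"
  define g where "g = sym_grade m mH v"
  define \<xi>1 where "\<xi>1 = (\<lambda>x. if \<kappa> = 0 then \<i> * freq_at p g * \<xi> (g + x)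
     + (case p of x0 \<Rightarrow> 1 | x1 \<Rightarrow> -1 | x2 \<Rightarrow> 0) * of_nat (snd (snd (snd g))) * \<xi> (g + x + (0, 0, 1, 0))
     else 0)"
  have "freq_at p (g + x) = freq_at p g + freq_at p x" for x
    by (cases p) (simp_all add: freq_at_def)
  \<comment> \<open>By additivity of the grade, the derivative splits into the contribution
    \<open>\<xi>1\<close> of the variable \<open>v\<close> and that of the remaining
    factors.\<close>
  then have split: "(\<lambda>x. shift_deriv p \<kappa> \<xi> (g + x))
      = (\<lambda>x. \<xi>1 x + shift_deriv p \<kappa> (\<lambda>x. \<xi> (g + x)) x)"
    by (auto simp: fun_eq_iff \<xi>1_def shift_deriv_def algebra_simps)
  have "E \<xi> (d * e) = sym_weight m mH h v * E \<xi>1 e"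
  proof (cases v)
    case (At q j)
    obtain D f where j: "j = Jet D f"
      by (cases j)
    show ?thesis
      by (cases p; cases q) (auto simp: E_def d_def \<xi>1_def g_def At j jD_def sym_weight_def
          sym_grade_def freq_at_def graded_eval_Var_mult graded_eval_char_scale cong: if_cong)
  next
    case (Del q r D)
    let ?w = "sym_weight m mH h v"
    let ?\<xi>' = "\<lambda>x. \<xi> (g + x + (0, 0, 1, 0))"
    have "E \<xi> (Var (Del q r (add_mset (Dop \<kappa>) D)) * e)
        = (if \<kappa> = 0 then orient q r else 0) * ?w * E ?\<xi>' e"
      by (simp add: E_def graded_eval_Var_mult sym_weight_Dop sym_grade_Dop Del g_def add_ac)
    then have "E \<xi> (d * e) = ((if p = q then 1 else 0) - (if p = r then 1 else 0))
        * ((if \<kappa> = 0 then orient q r else 0) * ?w * E ?\<xi>' e)"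
      by (simp add: d_def Del graded_eval_uminus E_def)
    moreover have "((if p = q then 1 else 0) - (if p = r then 1 else 0)) * orient q r * ?w
        = (case p of x0 \<Rightarrow> 1 | x1 \<Rightarrow> -1 | x2 \<Rightarrow> 0) * ?w"
      by (cases p; cases q; cases r) (simp_all add: Del sym_weight_def orient_def)
    moreover have "\<xi>1 = (\<lambda>x. if \<kappa> = 0 then (case p of x0 \<Rightarrow> 1 | x1 \<Rightarrow> -1 | x2 \<Rightarrow> 0) * ?\<xi>' x else 0)"
      by (cases p) (simp_all add: \<xi>1_def g_def Del sym_grade_def freq_at_def fun_eq_iff)
    ultimately show ?thesis
      by (cases "\<kappa> = 0") (simp_all add: E_def graded_eval_char_scale flip: mult.assoc)
  qed
  then show ?case
    using Var[of "\<lambda>x. \<xi> (g + x)"]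
    by (simp add: E_def dN_def derivation_eq_leib leib_mult d_def[symmetric] graded_eval_add
        graded_eval_Var_mult g_def[symmetric] split graded_eval_char_add distrib_left)
qed

text \<open>Up to a scalar, derivatives preserve the Fourier functional, since a total frequency is
  fixed and the transform is taken at a single point.\<close>

lemma shift_deriv_fourier:
  "\<exists>z. shift_deriv p \<kappa> (fourier T) = (\<lambda>x. z * fourier T x)"
proof -
  have nz: "1 - \<i> * complex_of_real a \<noteq> 0" for a
    by (simp add: complex_eq_iff)
  \<comment> \<open>With \<open>a0 + a1 = T\<close>, the eigenvalues are i a0 + (1 - i a0) = 1 at
    \<open>x0\<close> and i a1 - (1 - i a0) = iT - 1 at \<open>x1\<close>. The base 1 - i a0 has
    real part 1, so negative powers are harmless.\<close>
  let ?z = "if \<kappa> = 0 then (case p of x0 \<Rightarrow> 1 | x1 \<Rightarrow> \<i> * T - 1 | x2 \<Rightarrow> 0) else 0"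
  have "shift_deriv p \<kappa> (fourier T) x = ?z * fourier T x" for x
  proof -
    obtain a0 a1 n d where x: "x = (a0, a1, n, d)"
      by (cases x)
    let ?k = "1 - \<i> * complex_of_real a0"
    show ?thesis
    proof (cases "d = 1 \<and> a0 + a1 = T")
      case True
      then have f: "fourier T x = ?k powi n" "fourier T (x + (0, 0, 1, 0)) = ?k powi n * ?k"
        and T: "T = a0 + a1"
        using nz[of a0] by (simp_all add: x fourier_def power_int_add_1)
      show ?thesis
        unfolding shift_deriv_def f using True
        by (cases p) (simp_all add: x freq_at_def T algebra_simps)
    next
      case False
      then show ?thesis
        by (auto simp: shift_deriv_def fourier_def x)
    qed
  qed
  then show ?thesis
    by (intro exI[of _ ?z]) auto
qed

section \<open>Vanishing of the functional on the generators\<close>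

lemma freq_simps:
  "freq m mH (FA \<kappa> a) = m" "freq m mH (FB \<kappa> a) = m" "freq m mH (FF \<kappa> \<sigma> a) = m"
  "freq m mH (FPhi a) = m" "freq m mH (FW a) = m" "freq m mH FH = mH"
  "freq m mH (FJ \<kappa> a) = m" "freq m mH (FJ5 \<kappa> a) = m"
  by (simp_all add: freq_def)

lemma ampl_simps:
  "ampl m h (FA \<kappa> a) = (if \<kappa> = 0 \<and> a = 1 then \<i> * m else 0)" "ampl m h (FB \<kappa> a) = 0"
  "ampl m h (FF \<kappa> \<sigma> a) = 0" "ampl m h (FPhi a) = (if a = 1 then 1 else 0)"
  "ampl m h (FW a) = (if a = 1 then 1 else 0)" "ampl m h FH = h"
  "ampl m h (FJ \<kappa> a) = 0" "ampl m h (FJ5 \<kappa> a) = 0"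
  by (simp_all add: ampl_def)

text \<open>Quantifying over all multipliers \<open>f\<close> builds in closure under
  multiplication, which the kernel of the functional need not have.\<close>

definition annihilator :: "real \<Rightarrow> real \<Rightarrow> complex \<Rightarrow> real \<Rightarrow> npt set" where
  "annihilator m mH h T =
     {e. \<forall>f. graded_eval (sym_weight m mH h) (sym_grade m mH) (fourier T) (e * f) = 0}"

lemma annihilator_dN:
  assumes "e \<in> annihilator m mH h T"
  shows "dN p \<kappa> e \<in> annihilator m mH h T"
proof -
  obtain z where z: "shift_deriv p \<kappa> (fourier T) = (\<lambda>x. z * fourier T x)"
    using shift_deriv_fourier by blast
  \<comment> \<open>By the Leibniz rule it suffices to treat a derivative of a multiple of
    \<open>e\<close>, on which the functional acts by a scalar, and another multiple of
    \<open>e\<close>.\<close>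
  have "dN p \<kappa> e * f = dN p \<kappa> (e * f) - e * dN p \<kappa> f" for f
    by (simp add: dN_def derivation_eq_leib leib_mult)
  then show ?thesis
    using assms by (simp add: annihilator_def graded_eval_diff graded_eval_dN z
        graded_eval_char_scale)
qed

lemmas At_simps = sym_weight_def sym_grade_def freq_simps ampl_simps

lemma sum_eta: "(\<Sum>\<nu>\<in>UNIV. Rc (eta \<mu> \<nu>) * X \<nu>) = Rc (eta \<mu> \<mu>) * X \<mu>"
proof -
  have "(\<Sum>\<nu>\<in>UNIV. Rc (eta \<mu> \<nu>) * X \<nu>) = (\<Sum>\<nu>\<in>UNIV. if \<mu> = \<nu> then Rc (eta \<mu> \<nu>) * X \<nu> else 0)"
    by (rule sum.cong) (auto simp: eta_def)
  then show ?thesis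
    by simp
qed

lemma sum_only_0: "(\<And>\<mu>. \<mu> \<noteq> 0 \<Longrightarrow> f \<mu> = 0) \<Longrightarrow> (\<Sum>\<mu>\<in>(UNIV :: 4 set). f \<mu>) = f 0"
  using sum.mono_neutral_right[of "UNIV :: 4 set" "{0}" f] by simp

text \<open>The chosen fields solve the equations. All terms of one equation have the same grade, so
  the solution property makes every multiple vanish.\<close>

lemma annihilator_field_eqs:
  assumes "r \<in> field_eqs c c5 m mH"
  shows "place p r \<in> annihilator m mH h T"
proof -
  have "\<i> * (x * (\<i> * y)) = - (x * y)" for x y
    using mult.assoc[of \<i> \<i> "x * y"] by (simp add: mult.left_commute)
  with assms show ?thesis
    by (cases; cases p)
      (auto simp: annihilator_def dW_def derivation_eq_leib low_def Bf_def Ff_def phi_def Af_def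
        Wf_def Hf_def Jf_def sum_eta leib_simps place_simps jD_def distrib_right left_diff_distrib
        sum_distrib_right graded_eval_simps mult.assoc At_simps sum_only_0 eta_def power2_eq_square)
qed

lemma orient_swap: "orient q p = - orient p q"
  by (cases p; cases q) (simp_all add: orient_def)

text \<open>Reversing the orientation changes the sign of every operator; exchanging
  \<open>Iop\<close> and \<open>Iop'\<close> restores it for string integrations. Only the
  derivatives leave a sign.\<close>

lemma sym_weight_reflect:
  "sym_weight m mH h (Del p q D)
     = (-1) ^ ord_op D * sym_weight m mH h (Del q p (image_mset swap_op D))"
proof -
  have "(\<Prod>s\<in>#D. z * op_sign s) = (-1) ^ ord_op D * (\<Prod>s\<in>#image_mset swap_op D. - z
      * op_sign s)" for z
  proof (induction D)
    case (add s D)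
    then show ?case
      by (cases s) (simp_all add: ord_op_def swap_op_def op_sign_def)
  qed (simp add: ord_op_def)
  then show ?thesis
    unfolding sym_weight_def by (simp add: orient_swap[of q p])
qed

lemma sym_grade_reflect:
  "sym_grade m mH (Del q p (image_mset swap_op D)) = sym_grade m mH (Del p q D)"
proof -
  have "op_order (swap_op s) = op_order s" for s
    by (cases s) (simp_all add: op_order_def swap_op_def)
  then show ?thesis
    by (simp add: sym_grade_def multiset.map_comp comp_def)
qed

text \<open>Moving a field between \<open>x0\<close> and \<open>x1\<close> shifts frequency between
  them but keeps the total. The functional sees the individual frequencies only through the power of
  derivatives, which is 0 here.\<close>

lemma annihilator_localize:
  "(Var (At p j) - Var (At q j)) * delta p q \<in> annihilator m mH h T"
proof -
  obtain D f where j: "j = Jet D f"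
    by (cases j)
  \<comment> \<open>Exactly one delta function survives in \<open>fourier\<close>, and the given
    factor already supplies it. The cofactor then has none, hence derivative order 0.\<close>
  define R where "R = (\<lambda>x :: grade. snd (snd (snd x)) = 0 \<longrightarrow> fst (snd (snd x)) = 0)"
  define g where "g r = sym_grade m mH (At r j) + sym_grade m mH (Del p q {#})" for r
  have step: "R (sym_grade m mH s + x)" if "R x" for s x
    using that by (cases s) (auto simp: R_def sym_grade_def split: jet.split)
  have "graded_eval (sym_weight m mH h) (sym_grade m mH) (\<lambda>x. fourier T (g p + x)) e
      = graded_eval (sym_weight m mH h) (sym_grade m mH) (\<lambda>x. fourier T (g q + x)) e"
    if "orient p q \<noteq> 0" for e
  proof (rule graded_eval_cong[of R])
    show "fourier T (g p + x) = fourier T (g q + x)" if "R x" for x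
      using \<open>orient p q \<noteq> 0\<close> that
      by (cases x) (auto simp: g_def j R_def sym_grade_def fourier_def orient_def ac_simps split:
          if_splits)
  qed (use step in \<open>auto simp: R_def\<close>)
  moreover have "sym_weight m mH h (At p j) = sym_weight m mH h (At q j)" if "orient p q \<noteq> 0"
    using that by (auto simp: sym_weight_def j orient_def split: if_splits)
  moreover have "sym_weight m mH h (Del p q {#}) = 0" if "orient p q = 0"
    using that by (simp add: sym_weight_def)
  ultimately show ?thesis
    by (cases "orient p q = 0")
      (simp_all add: annihilator_def delta_def left_diff_distrib mult.assoc graded_eval_simps
          g_def add.assoc)
qed

text \<open>The functional keeps only monomials with exactly one delta function; this disposes of
  \<open>localize_Del\<close>.\<close>

lemma annihilator_two_deltas: "Var (Del p q D) * (Var (Del r s D') * e) \<in> annihilator m mH h T"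
proof -
  have "fourier T (sym_grade m mH (Del p q D) + (sym_grade m mH (Del r s D') + x)) = 0" for x
    by (cases x) (simp add: fourier_def sym_grade_def)
  then show ?thesis
    by (simp add: annihilator_def mult.assoc graded_eval_Var_mult)
qed

lemma annihilator_diff:
  "e \<in> annihilator m mH h T \<Longrightarrow> f \<in> annihilator m mH h T \<Longrightarrow> e - f \<in> annihilator m mH h T"
  by (simp add: annihilator_def left_diff_distrib graded_eval_diff)

lemma null_ideal_annihilator:
  assumes "e \<in> null_ideal c c5 m mH"
  shows "e \<in> annihilator m mH h T"
  using assms
proof induction
  case (field_eq r p)
  then show ?case
    by (rule annihilator_field_eqs)
next
  case (reflect p q D)
  then show ?case
    by (simp add: annihilator_def left_diff_distrib mult.assoc graded_eval_simps sym_grade_reflect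
        sym_weight_reflect[of m mH h p q D])
next
  case (localize p q j)
  show ?case
    by (rule annihilator_localize)
next
  case (localize_Del p q r D)
  then show ?case
    using annihilator_two_deltas[of _ _ _ _ _ _ 1]
    by (simp add: left_diff_distrib delta_def annihilator_diff)
next
  \<comment> \<open>The extra pair of \<open>Iop 0\<close> and \<open>Dop 0\<close> has order 0 and
    contributes the factor -1, cancelling the second term.\<close>
  case (string p q D)
  then show ?case
    by (simp add: annihilator_def sum_eta sum_distrib_right distrib_right mult.assoc
        graded_eval_simps
        sym_weight_def sym_grade_def op_sign_def op_order_def sum_only_0 eta_def)
      (simp add: orient_def)
next
  case (string' p q D)
  then show ?case
    by (simp add: annihilator_def sum_eta sum_distrib_right left_diff_distrib mult.assoc
        graded_eval_simps
        sym_weight_def sym_grade_def op_sign_def op_order_def sum_only_0 eta_def)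
      (simp add: orient_def)
next
  case (add e f)
  then show ?case
    by (simp add: annihilator_def distrib_right graded_eval_add)
next
  case (mult e f)
  then show ?case
    by (simp add: annihilator_def mult.assoc[symmetric] mult.commute[of f])
      (simp add: mult.assoc)
next
  case (deriv e p \<kappa>)
  then show ?case
    by (simp add: annihilator_dN)
qed

text \<open>The two terms have total frequencies 2m + 3M and 4m + M, where M is the Higgs mass, and
  scale as h^3 and h with the Higgs amplitude.\<close>

lemma quartic_not_null:
  assumes "place x0 (ip Wf phi * (Rc \<alpha> * Hf ^ 3 + Rc \<beta> * ip phi phi * Hf)) * (Const \<i> * delta x0 x1)
    \<in> null_ideal c c5 m mH"
  shows "\<alpha> = 0 \<and> \<beta> = 0"
proof -
  have sum1: "(\<Sum>a\<in>(UNIV :: 3 set). f a) = f 1" if "\<And>a. a \<noteq> 1 \<Longrightarrow> f a = 0" for f :: "3 \<Rightarrow> complex"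
    using sum.mono_neutral_right[of "UNIV :: 3 set" "{1}" f] that by simp
  let ?T1 = "2 * m + 3 * mH" and ?T2 = "4 * m + mH"
  have eq: "(if T = ?T1 then \<alpha> * h ^ 3 else 0) + (if T = ?T2 then \<beta> * h else 0) = 0" for T h :: real
  proof -
    have "graded_eval (sym_weight m mH h) (sym_grade m mH) (fourier T)
        (place x0 (ip Wf phi * (Rc \<alpha> * Hf ^ 3 + Rc \<beta> * ip phi phi * Hf)) * (Const \<i> * delta x0 x1)
            * 1)
      = \<i> * complex_of_real ((if T = ?T1 then \<alpha> * h ^ 3 else 0) + (if T = ?T2 then \<beta> * h else 0))"
      by (auto simp: ip_def Wf_def phi_def Hf_def delta_def place_simps power3_eq_cube distrib_left
          distrib_right sum_distrib_left sum_distrib_right mult.assoc graded_eval_simps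
          graded_eval_Var At_simps sum1 fourier_def orient_def mult.left_commute)
    moreover have "graded_eval (sym_weight m mH h) (sym_grade m mH) (fourier T)
        (place x0 (ip Wf phi * (Rc \<alpha> * Hf ^ 3 + Rc \<beta> * ip phi phi * Hf)) * (Const \<i> * delta x0 x1)
            * 1) = 0"
      using null_ideal_annihilator[OF assms, of h T] unfolding annihilator_def by blast
    ultimately have "complex_of_real ((if T = ?T1 then \<alpha> * h ^ 3 else 0) +
        (if T = ?T2 then \<beta> * h else 0)) = 0"
      by (metis complex_i_not_zero mult_eq_0_iff)
    then show ?thesis
      by (simp only: of_real_eq_0_iff)
  qed
  \<comment> \<open>If the two frequencies coincide (M = m), the amplitudes h = 1 and h = 2 still
    separate the cubic from the linear dependence.\<close>
  show ?thesis
    using eq[of ?T1 1] eq[of ?T1 2] eq[of ?T2 1] eq[of ?T2 2] by (auto split: if_splits)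
qed

section \<open>Lie algebra identities\<close>

text \<open>Since i * i = -1, \<open>ibr\<close> is minus the cross product. The Lie algebra
  identities reduce to polynomial identities in three components.\<close>

lemma ibr_components:
  "ibr X Y 1 = X 3 * Y 2 - X 2 * Y 3"
  "ibr X Y 2 = X 1 * Y 3 - X 3 * Y 1"
  "ibr X Y 3 = X 2 * Y 1 - X 1 * Y 2"
proof -
  have "Const \<i> * (Const \<i> * p) = - p" "Const \<i> * (Const (- \<i>) * p) = p" for p :: "'a mpoly"
    by (simp_all flip: mult.assoc Const_mult add: Const_uminus)
  then show "ibr X Y 1 = X 3 * Y 2 - X 2 * Y 3"
    "ibr X Y 2 = X 1 * Y 3 - X 3 * Y 1"
    "ibr X Y 3 = X 2 * Y 1 - X 1 * Y 2"
    by (simp_all add: ibr_def bracket_def sum_3 eps_def distrib_left mult.assoc)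
qed

lemma lie_cases: "P (1 :: 3) \<Longrightarrow> P 2 \<Longrightarrow> P 3 \<Longrightarrow> P c"
  using exhaust_3[of c] by auto

lemma ibr_antisym: "ibr Y X c = - ibr X Y c"
  by (rule lie_cases[of _ c]) (simp_all add: ibr_components)

lemma ip_commute: "ip X Y = ip Y X"
  by (simp add: ip_def mult.commute)

lemma ip_ibr_self: "ip U (ibr W U) = 0"
  by (simp add: ip_def sum_3 ibr_components algebra_simps)

text \<open>With Z = i[X,Y], invariance and the Jacobi identity turn the sum into <Z | i[Z,W]> =
  0.\<close>

lemma ip_ibr_swap: "ip (ibr X (ibr X Y)) (ibr W Y) + ip (ibr Y (ibr Y X)) (ibr W X) = 0"
  by (simp add: ip_def sum_3 ibr_components algebra_simps)

lemma ibr_scale: "ibr (\<lambda>a. z * X a) Y c = z * ibr X Y c" "ibr X (\<lambda>a. z * Y a) c = z * ibr X Y c"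
  by (rule lie_cases[of _ c]; simp add: ibr_components algebra_simps)+

lemma ibr_zero: "ibr (\<lambda>a. 0) Y c = 0" "ibr X (\<lambda>a. 0) c = 0"
  by (rule lie_cases[of _ c]; simp add: ibr_components)+

lemma ibr_sum: "(\<Sum>i\<in>A. ibr X (Y i) c) = ibr X (\<lambda>a. \<Sum>i\<in>A. Y i a) c"
  by (rule lie_cases[of _ c]) (simp_all add: ibr_components sum_subtractf sum_distrib_left)

lemma ip_scale: "ip (\<lambda>a. z * X a) Y = z * ip X Y" "ip X (\<lambda>a. z * Y a) = z * ip X Y"
  by (simp_all add: ip_def sum_distrib_left ac_simps)

lemma ip_sum: "(\<Sum>i\<in>A. ip X (Y i)) = ip X (\<lambda>a. \<Sum>i\<in>A. Y i a)"
  unfolding ip_def by (subst sum.swap) (simp add: sum_distrib_left)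

lemma ip_zero: "ip (\<lambda>a. 0) Y = 0" "ip X (\<lambda>a. 0) = 0"
  by (simp_all add: ip_def)

lemma poly_subst_ibr: "poly_subst s (ibr X Y c)
    = ibr (\<lambda>a. poly_subst s (X a)) (\<lambda>a. poly_subst s (Y a)) c"
  by (rule lie_cases[of _ c]) (simp_all add: ibr_components poly_subst_simps)

lemma poly_subst_ip: "poly_subst s (ip X Y) = ip (\<lambda>a. poly_subst s (X a)) (\<lambda>a. poly_subst s (Y a))"
  by (simp add: ip_def poly_subst_simps)

lemma leib_ibr: "leib s G (ibr X Y c)
    = ibr (\<lambda>a. leib s G (X a)) (\<lambda>a. poly_subst s (Y a)) c
      + ibr (\<lambda>a. poly_subst s (X a)) (\<lambda>a. leib s G (Y a)) c"
  by (rule lie_cases[of _ c]) (simp_all add: ibr_components leib_simps algebra_simps)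

lemma leib_ip: "leib s G (ip X Y)
    = ip (\<lambda>a. leib s G (X a)) (\<lambda>a. poly_subst s (Y a))
      + ip (\<lambda>a. poly_subst s (X a)) (\<lambda>a. leib s G (Y a))"
  by (simp add: ip_def leib_simps sum.distrib)

lemma low_eq: "low X \<mu> = (\<lambda>a. Rc (eta \<mu> \<mu>) * X \<mu> a)"
  by (simp add: low_def sum_eta fun_eq_iff)

lemma eta_square [simp]: "eta \<mu> \<mu> * eta \<mu> \<mu> = 1"
  by (simp add: eta_def)

lemma Rc_eta_square [simp]: "Rc (eta \<mu> \<mu>) * Rc (eta \<mu> \<mu>) = 1"
  "Rc (eta \<mu> \<mu>) * (Rc (eta \<mu> \<mu>) * p) = p"
proof -
  show "Rc (eta \<mu> \<mu>) * Rc (eta \<mu> \<mu>) = (1 :: 'a mpoly)"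
    by (simp flip: Const_mult of_real_mult)
  then show "Rc (eta \<mu> \<mu>) * (Rc (eta \<mu> \<mu>) * p) = p" for p :: "'b mpoly"
    by (simp flip: mult.assoc) (simp flip: Const_mult of_real_mult)
qed

lemma Const_numeral [simp]: "Const (numeral n) = numeral n"
  by (simp add: Const_def)

lemma Rc_mult: "Rc x * Rc y = Rc (x * y)" "Rc x * (Rc y * p) = Rc (x * y) * p"
  by (simp_all add: Const_mult mult.assoc)

lemma double_eq_0: "p + p = 0 \<Longrightarrow> p = (0 :: 'v mpoly)"
proof -
  assume "p + p = 0"
  then have "Const (1/2) * (p + p) = 0"
    by simp
  also have "Const (1/2) * (p + p) = (Const (1/2) + Const (1/2)) * p"
    by (simp add: algebra_simps)
  finally show ?thesis
    by (simp flip: Const_add)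
qed

section \<open>Derivations of the self-interaction and of \<open>Q2_loc\<close>\<close>

lemma L2_self_eq: "L2_self cF = - Rc ((1 + cF) / 2) * (\<Sum>\<kappa>\<in>UNIV. \<Sum>\<sigma>\<in>UNIV.
    Rc (eta \<kappa> \<kappa>) * (Rc (eta \<sigma> \<sigma>) * ip (ibr (Af \<kappa>) (Af \<sigma>)) (ibr (Af \<kappa>) (Af \<sigma>))))"
  by (simp add: L2_self_def low_eq ibr_scale[abs_def] ip_scale)

lemma leib_L2_self: "leib s G (L2_self cF) = - Rc (1 + cF) * (\<Sum>\<kappa>\<in>UNIV. \<Sum>\<sigma>\<in>UNIV.
    Rc (eta \<kappa> \<kappa>) * (Rc (eta \<sigma> \<sigma>) * ip (ibr (\<lambda>a. s (jA \<kappa> a)) (\<lambda>a. s (jA \<sigma> a)))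
      (\<lambda>c. ibr (\<lambda>a. G (jA \<kappa> a)) (\<lambda>a. s (jA \<sigma> a)) c + ibr (\<lambda>a. s (jA \<kappa> a)) (\<lambda>a. G (jA \<sigma> a)) c)))"
proof -
  have half: "Const (z / 2) * (x * (y * (2 * p))) = Const z * (x * (y * p))"
    for z and p x y :: "'a mpoly"
  proof -
    have "Const z = Const (z / 2) * 2"
      using Const_mult[of "z / 2" 2] by simp
    then have "Const z * (x * (y * p)) = Const (z / 2) * 2 * (x * (y * p))"
      by (rule arg_cong)
    then show ?thesis
      by (simp only: ac_simps)
  qed
  show ?thesis
    unfolding L2_self_eq
    by (simp add: leib_simps leib_ip leib_ibr Af_def poly_subst_ibr[abs_def] poly_subst_simps
        ip_commute[of "\<lambda>c. _ c + _ c"] sum_distrib_left half)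
qed

lemma Q2_loc_eq: "Q2_loc cF \<mu> = - Rc (2 * (1 + cF)) * (\<Sum>\<sigma>\<in>UNIV. Rc (eta \<sigma> \<sigma>)
    * ip (ibr (Af \<mu>) (Af \<sigma>)) (ibr Wf (Af \<sigma>)))"
proof -
  \<comment> \<open>Contracting the derivative with respect to \<open>A\<^sup>\<mu>\<close> with
    \<open>w\<close> is the derivation that sends \<open>A\<^sup>\<mu>\<close> to \<open>w\<close>
    and all other fields to 0.\<close>
  let ?D = "\<lambda>j. \<Sum>a\<in>UNIV. Wf a * (if j = jA \<mu> a then 1 else 0)"
  let ?t = "\<lambda>\<kappa> \<sigma>. ip (ibr (Af \<kappa>) (Af \<sigma>)) (ibr Wf (Af \<sigma>))"
  have D: "?D (jA \<kappa> b) = (if \<kappa> = \<mu> then Wf b else 0)" for \<kappa> b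
    by (simp add: if_distrib cong: if_cong)
  have t: "ip (ibr (Af \<kappa>) (Af \<sigma>)) (\<lambda>c. ibr (\<lambda>a. ?D (jA \<kappa> a)) (Af \<sigma>) c
        + ibr (Af \<kappa>) (\<lambda>a. ?D (jA \<sigma> a)) c)
      = (if \<kappa> = \<mu> then ?t \<mu> \<sigma> else 0) + (if \<sigma> = \<mu> then ?t \<mu> \<kappa> else 0)" for \<kappa> \<sigma>
    unfolding D
    by (cases "\<kappa> = \<mu>"; cases "\<sigma> = \<mu>")
      (simp_all add: ip_def sum_3 ibr_components algebra_simps)
  have sum_if: "(\<Sum>i\<in>A. if P then f i else 0) = (if P then \<Sum>i\<in>A. f i else 0)"
    for A P and f :: "4 \<Rightarrow> wick"
    by simp
  have "Q2_loc cF \<mu> = Rc (eta \<mu> \<mu>) * leib Var ?D (L2_self cF)"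
    by (simp add: Q2_loc_def sum_eta ip_scale)
      (simp add: ip_def pd_eq_leib leib_sum_right[symmetric] leib_scale mult.commute)
  also have "\<dots> = - (Rc (eta \<mu> \<mu>) * (Rc (1 + cF) * (\<Sum>\<kappa>\<in>UNIV. \<Sum>\<sigma>\<in>UNIV.
    Rc (eta \<kappa> \<kappa>) * (Rc (eta \<sigma> \<sigma>)
      * ((if \<kappa> = \<mu> then ?t \<mu> \<sigma> else 0) + (if \<sigma> = \<mu> then ?t \<mu> \<kappa> else 0))))))"
    unfolding leib_L2_self t[unfolded Af_def] Af_def by simp
  also have "(\<Sum>\<kappa>\<in>UNIV. \<Sum>\<sigma>\<in>UNIV. Rc (eta \<kappa> \<kappa>) * (Rc (eta \<sigma> \<sigma>)
      * ((if \<kappa> = \<mu> then ?t \<mu> \<sigma> else 0) + (if \<sigma> = \<mu> then ?t \<mu> \<kappa> else 0))))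
    = Rc (eta \<mu> \<mu>) * (\<Sum>\<sigma>\<in>UNIV. Rc (eta \<sigma> \<sigma>) * ?t \<mu> \<sigma>)
      + Rc (eta \<mu> \<mu>) * (\<Sum>\<sigma>\<in>UNIV. Rc (eta \<sigma> \<sigma>) * ?t \<mu> \<sigma>)"
    by (simp add: distrib_left sum.distrib if_distrib[of "(*) _"] sum_if cong: if_cong)
      (simp add: sum_distrib_left mult.left_commute)
  finally show ?thesis
    by (simp add: Const_mult Const_add algebra_simps)
qed

lemma leib_Q2_loc_cong:
  assumes "\<And>\<nu> a. G (jA \<nu> a) = G' (jA \<nu> a)" "\<And>a. G (jW a) = G' (jW a)"
  shows "leib s G (Q2_loc cF \<mu>) = leib s G' (Q2_loc cF \<mu>)"
  by (simp add: Q2_loc_eq leib_simps leib_ip leib_ibr Af_def Wf_def assms)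

text \<open>The contributions of (\<mu>,\<sigma>) and (\<sigma>,\<mu>) cancel by
  \<open>ip_ibr_swap\<close>, while the metric factors are symmetric.\<close>

lemma leib_Q2_loc_0:
  assumes A: "\<And>\<mu> \<nu> a. R \<mu> (jA \<nu> a) = z * (Rc (eta \<mu> \<mu>) * ibr (Af \<mu>) (Af \<nu>) a)"
    and W: "\<And>\<mu> a. R \<mu> (jW a) = 0"
  shows "(\<Sum>\<mu>\<in>UNIV. leib Var (R \<mu>) (Q2_loc cF \<mu>)) = 0"
proof -
  let ?t = "\<lambda>\<mu> \<sigma>. ip (ibr (Af \<mu>) (ibr (Af \<mu>) (Af \<sigma>))) (ibr Wf (Af \<sigma>))"
  let ?e = "\<lambda>\<mu>. Rc (eta \<mu> \<mu>) :: wick"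
  have t: "?t \<mu> \<sigma> + ?t \<sigma> \<mu> = 0" for \<mu> \<sigma>
    by (rule ip_ibr_swap)
  have "(\<Sum>\<mu>\<in>UNIV. leib Var (R \<mu>) (Q2_loc cF \<mu>))
      = (\<Sum>\<mu>\<in>UNIV. \<Sum>\<sigma>\<in>UNIV. - Rc (2 * (1 + cF)) * (z * (?e \<mu> * (?e \<sigma> * ?t \<mu> \<sigma>))))"
  proof (rule sum.cong[OF refl])
    fix \<mu>
    \<comment> \<open>Only the variation of \<open>Af \<sigma>\<close> in the first bracket
      survives: that of \<open>Af \<mu>\<close> is a bracket of \<open>A\<^sup>\<mu>\<close> with
      itself, and that in the second bracket gives <U | i[W,U]> = 0.\<close>
    have "leib Var (R \<mu>) (ip (ibr (Af \<mu>) (Af \<sigma>)) (ibr Wf (Af \<sigma>))) = z * (?e \<mu> * ?t \<mu> \<sigma>)" for \<sigma>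
    proof -
      have "leib Var (R \<mu>) (Af \<nu> a) = z * (?e \<mu> * ibr (Af \<mu>) (Af \<nu>) a)" for \<nu> a
        by (simp add: Af_def A)
      moreover have "leib Var (R \<mu>) (Wf a) = 0" for a
        by (simp add: Wf_def W)
      ultimately show ?thesis
        by (simp add: leib_ip leib_ibr)
          (simp add: ip_def sum_3 ibr_components algebra_simps)
    qed
    then show "leib Var (R \<mu>) (Q2_loc cF \<mu>)
        = (\<Sum>\<sigma>\<in>UNIV. - Rc (2 * (1 + cF)) * (z * (?e \<mu> * (?e \<sigma> * ?t \<mu> \<sigma>))))"
      by (simp add: Q2_loc_eq leib_simps sum_distrib_left sum_negf mult.left_commute)
  qed
  also have "\<dots> = - Rc (2 * (1 + cF)) * (z * (\<Sum>\<mu>\<in>UNIV. \<Sum>\<sigma>\<in>UNIV. ?e \<mu> * (?e \<sigma> * ?t \<mu> \<sigma>)))"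
    by (simp only: sum_distrib_left)
  also have "(\<Sum>\<mu>\<in>UNIV. \<Sum>\<sigma>\<in>UNIV. ?e \<mu> * (?e \<sigma> * ?t \<mu> \<sigma>)) = 0" (is "?S = 0")
  proof (rule double_eq_0)
    have "?S + ?S = ?S + (\<Sum>\<mu>\<in>UNIV. \<Sum>\<sigma>\<in>UNIV. ?e \<sigma> * (?e \<mu> * ?t \<sigma> \<mu>))"
      by (subst (3) sum.swap) (rule refl)
    also have "\<dots> = (\<Sum>\<mu>\<in>UNIV. \<Sum>\<sigma>\<in>UNIV. ?e \<mu> * (?e \<sigma> * (?t \<mu> \<sigma> + ?t \<sigma> \<mu>)))"
      by (simp only: sum.distrib distrib_left mult.left_commute)
    finally show "?S + ?S = 0"
      by (simp only: t mult_zero_right sum.neutral_const)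
  qed
  finally show ?thesis
    by simp
qed

section \<open>Evaluation of the obstruction map\<close>

lemma lookup_delta_part:
  "Poly_Mapping.lookup (delta_part v) D = (if stringy D then 0 else Poly_Mapping.lookup v D)"
proof -
  have "Poly_Mapping.lookup (delta_part v) D
      = (\<Sum>E\<in>{E \<in> Poly_Mapping.keys v. \<not> stringy E}. if E = D then Poly_Mapping.lookup v E else 0)"
    by (simp add: delta_part_def lookup_sum lookup_single when_def)
  also have "\<dots> = (if stringy D then 0 else Poly_Mapping.lookup v D)"
    by (subst sum.delta) (auto simp: in_keys_iff)
  finally show ?thesis .
qed

lemma delta_part_add: "delta_part (v + w) = delta_part v + delta_part w"
  by (rule poly_mapping_eqI) (simp add: lookup_delta_part lookup_add)

lemma delta_part_0 [simp]: "delta_part 0 = 0"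
  by (rule poly_mapping_eqI) (simp add: lookup_delta_part)

lemma delta_part_diff: "delta_part (v - w) = delta_part v - delta_part w"
  by (rule poly_mapping_eqI) (simp add: lookup_delta_part lookup_minus)

lemma delta_part_sum: "delta_part (\<Sum>i\<in>A. f i) = (\<Sum>i\<in>A. delta_part (f i))"
  by (induction A rule: infinite_finite_induct) (simp_all add: delta_part_add)

lemma delta_part_single:
  "delta_part (Poly_Mapping.single D c) = (if stringy D then 0 else Poly_Mapping.single D c)"
  by (rule poly_mapping_eqI) (auto simp: lookup_delta_part lookup_single when_def)

lemma delta_part_opr [simp]: "delta_part (opr r) = opr r"
  by (simp add: opr_def opc_def delta_part_single stringy_def)

lemma delta_part_opr_mult: "delta_part (opr r * v) = opr r * delta_part v"
proof (induction v rule: poly_mapping_single_add_induct)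
  case (single D c)
  then show ?case
    by (simp add: opr_def opc_def mult_single delta_part_single)
qed (simp add: delta_part_add distrib_left)

lemma delta_part_Iop':
  "delta_part (ops (Iop' \<nu>)) = 0" "delta_part (ops (Iop' \<nu>) * ops (Dop \<kappa>)) = 0"
  by (auto simp: ops_def mult_single delta_part_single stringy_def)

lemma opr_mult: "opr r * opr s = opr (r * s)"
  by (simp add: opr_def opc_def mult_single Const_mult)

lemma opr_1 [simp]: "opr 1 = 1" and opr_0 [simp]: "opr 0 = 0"
  by (simp_all add: opr_def opc_def)

lemma opr_uminus: "opr (- r) = - opr r"
  by (simp add: opr_def opc_def Const_uminus single_uminus)

lemma op_apply_add: "op_apply p q (v + w) = op_apply p q v + op_apply p q w"
  unfolding op_apply_def by (rule sum_keys_add) (simp_all add: place_simps distrib_right)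

lemma op_apply_0 [simp]: "op_apply p q 0 = 0"
  by (simp add: op_apply_def)

lemma op_apply_sum: "op_apply p q (\<Sum>i\<in>A. f i) = (\<Sum>i\<in>A. op_apply p q (f i))"
  by (induction A rule: infinite_finite_induct) (simp_all add: op_apply_add)

lemma op_apply_opr: "op_apply p q (opr r) = Rc r * (Const \<i> * delta p q)"
proof -
  have "op_apply p q (Poly_Mapping.single {#} (Rc r)) = place p (Rc r) * (Const \<i> * Var
      (Del p q {#}))"
    unfolding op_apply_def by (rule sum_keys_single) simp
  then show ?thesis
    by (simp add: opr_def opc_def delta_def)
qed

lemma sum_opr_eta: "(\<Sum>\<rho>\<in>UNIV. opr (eta \<nu> \<rho>) * X \<rho>) = opr (eta \<nu> \<nu>) * X \<nu>"
proof -
  have "(\<Sum>\<rho>\<in>UNIV. opr (eta \<nu> \<rho>) * X \<rho>) = (\<Sum>\<rho>\<in>UNIV. if \<nu> = \<rho> then opr (eta \<nu> \<rho>) * X \<rho> else 0)"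
    by (rule sum.cong) (auto simp: eta_def)
  then show ?thesis
    by simp
qed

text \<open>The table fixes the obstructions of A with a lowered index; multiplying by the diagonal
  metric once more raises it, as its entries square to 1.\<close>

lemma delta_part_eta_cancel:
  assumes "delta_part (\<Sum>\<rho>\<in>UNIV. opr (eta \<nu> \<rho>) * X \<rho>) = v"
  shows "delta_part (X \<nu>) = opr (eta \<nu> \<nu>) * v"
  using assms
  by (simp add: sum_opr_eta delta_part_opr_mult opr_mult flip: mult.assoc assms)

text \<open>The obstruction map is a derivation at \<open>q\<close> in \<open>X\<close> nested
  inside a derivation at \<open>p\<close> in \<open>Y\<close>, so it is determined by its values on
  pairs of fields.\<close>

lemma obs_eq_leib: "obs Ob p q Y X = (\<Sum>\<mu>\<in>UNIV. leib (\<lambda>j. Var (At p j))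
    (\<lambda>\<phi>. leib (\<lambda>j. Var (At q j)) (\<lambda>\<psi>. op_apply p q (Ob \<mu> \<phi> \<psi>)) X) (Y \<mu>))"
  by (simp add: obs_def leib_def place_def sum_distrib_left mult.assoc)

lemma leib_place:
  "leib (\<lambda>j. Var (At q j)) (\<lambda>\<psi>. place q (r \<psi>) * z) X = place q (leib Var r X) * z"
  using leib_scale[of "\<lambda>j. Var (At q j)" z "\<lambda>\<psi>. place q (r \<psi>)" X]
  by (simp add: mult.commute[of _ z] place_def poly_subst_leib)

text \<open>Only the fields occurring in \<open>L1\<close> matter, so two-point obstructions with
  other jets need not be known.\<close>

lemma leib_L1_cong:
  assumes "\<And>\<kappa> a. G (jA \<kappa> a) = G' (jA \<kappa> a)" "\<And>\<kappa> a. G (jB \<kappa> a) = G' (jB \<kappa> a)"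
    "\<And>\<kappa> \<sigma> a. G (jF \<kappa> \<sigma> a) = G' (jF \<kappa> \<sigma> a)" "\<And>a. G (jPhi a) = G' (jPhi a)"
    "G jH = G' jH" "\<And>\<kappa>. G (jdH \<kappa>) = G' (jdH \<kappa>)"
    "\<And>\<kappa> a. G (jJ \<kappa> a) = G' (jJ \<kappa> a)" "\<And>\<kappa> a. G (jJ5 \<kappa> a) = G' (jJ5 \<kappa> a)"
  shows "leib s G (L1 c c5 m mH a) = leib s G' (L1 c c5 m mH a)"
  by (simp add: L1_def low_eq leib_simps leib_ip leib_ibr Af_def Bf_def Ff_def phi_def Hf_def
      dHf_def
      Jf_def assms)

lemma leib_L2_cong:
  assumes "\<And>\<kappa> a. G (jA \<kappa> a) = G' (jA \<kappa> a)" "\<And>a. G (jPhi a) = G' (jPhi a)" "G jH = G' jH"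
  shows "leib s G (L2 cF m mH a b) = leib s G' (L2 cF m mH a b)"
  by (simp add: L2_def L2_self_eq L2_Higgs_def leib_simps leib_ip leib_ibr Af_def phi_def Hf_def
      assms)

lemma L2_zero: "leib s G (L2 cF m mH a b) = 0"
  if "\<And>\<kappa> a. G (jA \<kappa> a) = 0" "\<And>a. G (jPhi a) = 0" "G jH = 0"
  using leib_L2_cong[of G "\<lambda>j. 0" s cF m mH a b] that by simp

section \<open>Entries of the table, and the two local obstructions\<close>

lemma HK_sector: "HK_two_point c c5 m cF Ob \<Longrightarrow> sector \<phi> \<noteq> sector \<psi> \<Longrightarrow> Ob \<mu> \<phi> \<psi> = 0"
  by (simp add: HK_two_point_def)

lemma HK_Higgs:
  assumes "HK_two_point c c5 m cF Ob"
  shows "Ob \<mu> jH jH = 0" "(\<Sum>\<mu>\<in>UNIV. Ob \<mu> (jdH \<mu>) jH) = 1"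
  using assms by (simp_all add: HK_two_point_def)

lemma HK_B:
  assumes "HK_two_point c c5 m cF Ob"
  shows "(\<Sum>\<mu>\<in>UNIV. Ob \<mu> (jB \<mu> a) (jPhi b)) = - opr (kd a b / m^2)"
    "(\<Sum>\<mu>\<in>UNIV. Ob \<mu> (jB \<mu> a) (jA \<kappa> b)) = 0"
proof -
  have B: "\<forall>a b \<kappa> \<sigma>.
      (\<Sum>\<mu>\<in>UNIV. Ob \<mu> (jB \<mu> a) (jB \<kappa> b)) = 0 \<and>
      (\<Sum>\<mu>\<in>UNIV. Ob \<mu> (jB \<mu> a) (jPhi b)) = - opr (kd a b / m^2) \<and>
      (\<Sum>\<mu>\<in>UNIV. Ob \<mu> (jB \<mu> a) (jF \<kappa> \<sigma> b)) = 0 \<and>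
      (\<Sum>\<mu>\<in>UNIV. Ob \<mu> (jB \<mu> a) (jA \<kappa> b)) = 0"
    using assms unfolding HK_two_point_def by (elim conjE)
  show "(\<Sum>\<mu>\<in>UNIV. Ob \<mu> (jB \<mu> a) (jPhi b)) = - opr (kd a b / m^2)"
    "(\<Sum>\<mu>\<in>UNIV. Ob \<mu> (jB \<mu> a) (jA \<kappa> b)) = 0"
    using B by simp_all
qed

lemma HK_F:
  assumes "HK_two_point c c5 m cF Ob"
  shows "(\<Sum>\<mu>\<in>UNIV. Ob \<mu> (jF \<mu> \<nu> a) (jPhi b)) = - opr (kd a b) * ops (Iop' \<nu>)"
    "(\<Sum>\<mu>\<in>UNIV. Ob \<mu> (jF \<mu> \<nu> a) (jA \<kappa> b))
      = - opr (kd a b) * (opr (eta \<nu> \<kappa>) - ops (Iop' \<nu>) * ops (Dop \<kappa>))"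
proof -
  have F: "\<forall>\<nu> a b \<kappa> \<sigma>.
      (\<Sum>\<mu>\<in>UNIV. Ob \<mu> (jF \<mu> \<nu> a) (jB \<kappa> b)) = 0 \<and>
      (\<Sum>\<mu>\<in>UNIV. Ob \<mu> (jF \<mu> \<nu> a) (jPhi b)) = - opr (kd a b) * ops (Iop' \<nu>) \<and>
      (\<Sum>\<mu>\<in>UNIV. Ob \<mu> (jF \<mu> \<nu> a) (jF \<kappa> \<sigma> b)) =
        - opr (kd a b * (1 + cF)) *
          (opr (eta \<nu> \<kappa>) * ops (Dop \<sigma>) - opr (eta \<nu> \<sigma>) * ops (Dop \<kappa>)) \<and>
      (\<Sum>\<mu>\<in>UNIV. Ob \<mu> (jF \<mu> \<nu> a) (jA \<kappa> b)) =
        - opr (kd a b) * (opr (eta \<nu> \<kappa>) - ops (Iop' \<nu>) * ops (Dop \<kappa>))"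
    using assms unfolding HK_two_point_def by (elim conjE)
  show "(\<Sum>\<mu>\<in>UNIV. Ob \<mu> (jF \<mu> \<nu> a) (jPhi b)) = - opr (kd a b) * ops (Iop' \<nu>)"
    "(\<Sum>\<mu>\<in>UNIV. Ob \<mu> (jF \<mu> \<nu> a) (jA \<kappa> b))
      = - opr (kd a b) * (opr (eta \<nu> \<kappa>) - ops (Iop' \<nu>) * ops (Dop \<kappa>))"
    using F by simp_all
qed

lemma HK_phi_w:
  assumes "HK_two_point c c5 m cF Ob"
  shows "Ob \<mu> (jPhi a) (jPhi b) = 0" "Ob \<mu> (jPhi a) (jA \<kappa> b) = 0" "Ob \<mu> (jW a) \<psi> = 0"
  using assms unfolding HK_two_point_def by blast+

lemma HK_A:
  assumes "HK_two_point c c5 m cF Ob"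
  shows "delta_part (Ob \<mu> (jA \<nu> a) (jF \<kappa> \<sigma> b))
      = opr (- (eta \<nu> \<nu> * (kd a b * cF / 2 * (kd \<mu> \<kappa> * kd \<nu> \<sigma> - kd \<mu> \<sigma> * kd \<nu> \<kappa>))))"
    "delta_part (Ob \<mu> (jA \<nu> a) (jA \<kappa> b)) = 0"
    "delta_part (Ob \<mu> (jA \<nu> a) (jB \<kappa> b)) = 0"
    "delta_part (Ob \<mu> (jA \<nu> a) (jPhi b)) = 0"
proof -
  have A: "delta_part (\<Sum>\<rho>\<in>UNIV. opr (eta \<nu> \<rho>) * Ob \<mu> (jA \<rho> a) (jF \<kappa> \<sigma> b)) =
        - opr (kd a b * cF / 2 * (kd \<mu> \<kappa> * kd \<nu> \<sigma> - kd \<mu> \<sigma> * kd \<nu> \<kappa>))"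
      "delta_part (\<Sum>\<rho>\<in>UNIV. opr (eta \<nu> \<rho>) * Ob \<mu> (jA \<rho> a) (jA \<kappa> b)) = 0"
      "delta_part (\<Sum>\<rho>\<in>UNIV. opr (eta \<nu> \<rho>) * Ob \<mu> (jA \<rho> a) (jB \<kappa> b)) = 0"
      "delta_part (\<Sum>\<rho>\<in>UNIV. opr (eta \<nu> \<rho>) * Ob \<mu> (jA \<rho> a) (jPhi b)) = 0"
    using assms unfolding HK_two_point_def by blast+
  show "delta_part (Ob \<mu> (jA \<nu> a) (jF \<kappa> \<sigma> b))
      = opr (- (eta \<nu> \<nu> * (kd a b * cF / 2 * (kd \<mu> \<kappa> * kd \<nu> \<sigma> - kd \<mu> \<sigma> * kd \<nu> \<kappa>))))"
    unfolding delta_part_eta_cancel[OF A(1)] by (simp add: opr_mult opr_uminus)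
  show "delta_part (Ob \<mu> (jA \<nu> a) (jA \<kappa> b)) = 0"
    unfolding delta_part_eta_cancel[OF A(2)] by simp
  show "delta_part (Ob \<mu> (jA \<nu> a) (jB \<kappa> b)) = 0"
    unfolding delta_part_eta_cancel[OF A(3)] by simp
  show "delta_part (Ob \<mu> (jA \<nu> a) (jPhi b)) = 0"
    unfolding delta_part_eta_cancel[OF A(4)] by simp
qed

lemma sector_simps [simp]:
  "sector (jA \<kappa> a) = Proca" "sector (jB \<kappa> a) = Proca" "sector (jF \<kappa> \<sigma> a) = Proca"
  "sector (jPhi a) = Proca" "sector (jW a) = Proca" "sector jH = Higgs" "sector (jdH \<kappa>) = Higgs"
  "sector (jJ \<kappa> a) = Dirac" "sector (jJ5 \<kappa> a) = Dirac"
  by (simp_all add: sector_def)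

text \<open>The local obstruction of A is nonzero only on F, and L1 depends on F through <F |
  i[A,A]>. The result is a variation of A proportional to i[A,A], to which
  \<open>leib_Q2_loc_0\<close> applies.\<close>

lemma obs_delta_Q2_loc_L1:
  assumes HK: "HK_two_point c c5 m cF Ob"
  shows "eqv c c5 m mH (obs_delta Ob x0 x2 (Q2_loc cF) (L1 c c5 m mH a)) 0"
proof -
  \<comment> \<open>The local value of \<open>Ob \<mu> (jA \<nu> a')\<close> on the fields of
    \<open>L1\<close>, with its index raised.\<close>
  define r where "r \<mu> \<nu> a' \<psi> = (case \<psi> of Jet D f \<Rightarrow> (case f of FF \<kappa> \<sigma> b \<Rightarrow>
      - (eta \<nu> \<nu> * (kd a' b * cF / 2 * (kd \<mu> \<kappa> * kd \<nu> \<sigma> - kd \<mu> \<sigma> * kd \<nu> \<kappa>)))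
    | _ \<Rightarrow> 0))" for \<mu> \<nu> :: 4 and a' :: 3 and \<psi>
  define R where "R \<mu> \<phi> = (case \<phi> of Jet D f \<Rightarrow> (case f of
      FA \<nu> a' \<Rightarrow> leib Var (\<lambda>\<psi>. Rc (r \<mu> \<nu> a' \<psi>)) (L1 c c5 m mH a) | _ \<Rightarrow> 0))" for \<mu> \<phi>
  let ?z = "Const \<i> * delta x0 x2"
  let ?inner = "\<lambda>\<mu> \<phi>. leib (\<lambda>j. Var (At x2 j)) (\<lambda>\<psi>. op_apply x0 x2 (delta_part (Ob \<mu> \<phi> \<psi>)))
      (L1 c c5 m mH a)"
  have inner_W: "?inner \<mu> (jW a') = place x2 (R \<mu> (jW a')) * ?z" for \<mu> a'
    by (simp add: HK_phi_w[OF HK] R_def)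
  have inner_A: "?inner \<mu> (jA \<nu> a') = place x2 (R \<mu> (jA \<nu> a')) * ?z" for \<mu> \<nu> a'
  proof -
    have "?inner \<mu> (jA \<nu> a') = leib (\<lambda>j. Var (At x2 j)) (\<lambda>\<psi>. place x2 (Rc (r \<mu> \<nu> a' \<psi>)) * ?z)
        (L1 c c5 m mH a)"
      by (rule leib_L1_cong) (simp_all add: HK_A[OF HK] HK_sector[OF HK] op_apply_opr r_def)
    then show ?thesis
      by (simp only: leib_place R_def jet.case field.case)
  qed
  have "obs_delta Ob x0 x2 (Q2_loc cF) (L1 c c5 m mH a)
      = (\<Sum>\<mu>\<in>UNIV. leib (\<lambda>j. Var (At x0 j)) (\<lambda>\<phi>. place x2 (R \<mu> \<phi>) * ?z) (Q2_loc cF \<mu>))"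
    unfolding obs_delta_def obs_eq_leib by (intro sum.cong leib_Q2_loc_cong inner_W inner_A refl)
  also have "eqv c c5 m mH \<dots> (\<Sum>\<mu>\<in>UNIV. place x0 (leib Var (R \<mu>) (Q2_loc cF \<mu>)) * ?z)"
    by (intro eqv_sum leib_delta[unfolded derivation_eq_leib]) simp
  also have "(\<Sum>\<mu>\<in>UNIV. place x0 (leib Var (R \<mu>) (Q2_loc cF \<mu>)) * ?z)
      = place x0 (\<Sum>\<mu>\<in>UNIV. leib Var (R \<mu>) (Q2_loc cF \<mu>)) * ?z"
    by (simp only: place_simps sum_distrib_right)
  also have "(\<Sum>\<mu>\<in>UNIV. leib Var (R \<mu>) (Q2_loc cF \<mu>)) = 0"
  proof (rule leib_Q2_loc_0)
    show "R \<mu> (jA \<nu> a') = Rc (- cF / 2) * (Rc (eta \<mu> \<mu>) * ibr (Af \<mu>) (Af \<nu>) a')" for \<mu> \<nu> a'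
    proof -
      define q :: wick where "q = Rc (- (eta \<nu> \<nu> * cF / 2))"
      have r: "Rc (r \<mu> \<nu> a' (jF \<kappa> \<sigma> b)) = (if b = a' then
            (if \<kappa> = \<mu> then if \<sigma> = \<nu> then q else 0 else 0)
          - (if \<sigma> = \<mu> then if \<kappa> = \<nu> then q else 0 else 0) else 0)" for \<kappa> \<sigma> b
        by (auto simp: r_def kd_def q_def Const_uminus)
      have sum_if: "(\<Sum>i\<in>A. if P then f i else 0) = (if P then \<Sum>i\<in>A. f i else 0)"
        for A P and f :: "4 \<Rightarrow> wick"
        by simp
      have "R \<mu> (jA \<nu> a') = Rc (1/2) * (\<Sum>\<kappa>\<in>UNIV. \<Sum>\<sigma>\<in>UNIV. \<Sum>b\<in>UNIV.
          Rc (r \<mu> \<nu> a' (jF \<kappa> \<sigma> b)) * ibr (low Af \<kappa>) (low Af \<sigma>) b)"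
        by (simp add: R_def L1_def low_eq leib_simps leib_ip leib_ibr Af_def Bf_def Ff_def phi_def
            Hf_def dHf_def Jf_def r_def ip_def ibr_zero)
      also have "\<dots> = Rc (1/2) * (\<Sum>\<kappa>\<in>UNIV. \<Sum>\<sigma>\<in>UNIV.
          (if \<kappa> = \<mu> then if \<sigma> = \<nu> then q * ibr (low Af \<mu>) (low Af \<nu>) a' else 0 else 0)
         - (if \<sigma> = \<mu> then if \<kappa> = \<nu> then q * ibr (low Af \<nu>) (low Af \<mu>) a' else 0 else 0))"
        unfolding r by (intro arg_cong[of _ _ "(*) _"] sum.cong)
          (auto simp: if_distrib[of "\<lambda>x. x * _"] cong: if_cong)
      also have "\<dots> = Rc (1/2) * (q * ibr (low Af \<mu>) (low Af \<nu>) a' - q * ibr (low Af \<nu>)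
          (low Af \<mu>) a')"
        by (simp add: sum_subtractf sum_if)
      \<comment> \<open>Both orderings of the indices of F contribute equally, by antisymmetry of
        the bracket, which absorbs the factor 1/2.\<close>
      also have "\<dots> = (Const (1/2) + Const (1/2)) * (q * ibr (low Af \<mu>) (low Af \<nu>) a')"
        unfolding ibr_antisym[of "low Af \<nu>" "low Af \<mu>"] by (simp add: algebra_simps)
      also have "\<dots> = (q * Rc (eta \<nu> \<nu>)) * (Rc (eta \<mu> \<mu>) * ibr (Af \<mu>) (Af \<nu>) a')"
        by (simp add: low_eq ibr_scale[abs_def] mult.left_commute flip: Const_add)
      also have "q * Rc (eta \<nu> \<nu>) = Rc (- cF / 2)"
        unfolding q_def Const_mult[symmetric] of_real_mult[symmetric] by (simp add: eta_def)
      finally show ?thesis .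
    qed
  qed (simp add: R_def)
  finally show ?thesis
    by simp
qed

lemma leib_Q1:
  assumes "\<And>a. G (jW a) = 0" "\<And>\<kappa> a. G (jJ \<kappa> a) = 0" "\<And>\<kappa> a. G (jJ5 \<kappa> a) = 0"
    "\<And>\<kappa> a. G (jA \<kappa> a) = 0" "\<And>a. G (jPhi a) = 0" "G jH = 0"
  shows "leib s G (Q1 c c5 m \<mu>) =
    (\<Sum>\<nu>\<in>UNIV. ip (\<lambda>a. G (jF \<mu> \<nu> a)) (ibr (\<lambda>a. s (jW a)) (\<lambda>a. Rc (eta \<nu> \<nu>) * s (jA \<nu> a))))
    - Rc (m^2 / 2) * ip (\<lambda>a. s (jPhi a)) (ibr (\<lambda>a. s (jW a)) (\<lambda>a. G (jB \<mu> a)))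
    + Rc (m/2) * (ip (\<lambda>a. s (jW a)) (\<lambda>a. G (jB \<mu> a)) * s jH
        + ip (\<lambda>a. s (jW a)) (\<lambda>a. s (jPhi a)) * G (jdH \<mu>))"
  by (simp add: Q1_def low_eq leib_simps leib_ip leib_ibr Af_def Bf_def Ff_def phi_def Wf_def
      Hf_def dHf_def Jf_def ibr_zero ip_zero poly_subst_simps poly_subst_ip
      poly_subst_ibr[abs_def] assms)

text \<open>The obstruction index is contracted with the Lorentz index of the factor \<open>F\<close>, \<open>B\<close> or
  \<open>\<partial>H\<close> of \<open>Q\<^sub>1\<close>. The contracted expression is written as a derivation of the single component
  \<open>Q\<^sub>1\<^sup>0\<close>, whose index \<open>0\<close> serves as a placeholder.\<close>

lemma leib_Q1_contract:
  assumes zero: "\<And>\<mu> a. G \<mu> (jW a) = 0" "\<And>\<mu> \<kappa> a. G \<mu> (jJ \<kappa> a) = 0" "\<And>\<mu> \<kappa> a. G \<mu> (jJ5 \<kappa> a) = 0"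
      "\<And>\<mu> \<kappa> a. G \<mu> (jA \<kappa> a) = 0" "\<And>\<mu> a. G \<mu> (jPhi a) = 0" "\<And>\<mu>. G \<mu> jH = 0"
    and zeroK: "\<And>a. K (jW a) = 0" "\<And>\<kappa> a. K (jJ \<kappa> a) = 0" "\<And>\<kappa> a. K (jJ5 \<kappa> a) = 0"
      "\<And>\<kappa> a. K (jA \<kappa> a) = 0" "\<And>a. K (jPhi a) = 0" "K jH = 0"
    and K: "\<And>\<nu> a. K (jF 0 \<nu> a) = (\<Sum>\<mu>\<in>UNIV. G \<mu> (jF \<mu> \<nu> a))"
      "\<And>a. K (jB 0 a) = (\<Sum>\<mu>\<in>UNIV. G \<mu> (jB \<mu> a))" "K (jdH 0) = (\<Sum>\<mu>\<in>UNIV. G \<mu> (jdH \<mu>))"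
  shows "(\<Sum>\<mu>\<in>UNIV. leib s (G \<mu>) (Q1 c c5 m \<mu>)) = leib s K (Q1 c c5 m 0)"
proof -
  have swap: "(\<Sum>\<mu>\<in>UNIV. \<Sum>\<nu>\<in>UNIV. ip (\<lambda>a. G \<mu> (jF \<mu> \<nu> a)) (X \<nu>))
    = (\<Sum>\<nu>\<in>UNIV. ip (\<lambda>a. \<Sum>\<mu>\<in>UNIV. G \<mu> (jF \<mu> \<nu> a)) (X \<nu>))" for X :: "4 \<Rightarrow> 3 \<Rightarrow> 'a mpoly"
    by (subst sum.swap) (simp add: ip_commute[of _ "X _"] ip_sum)
  show ?thesis
    by (simp add: leib_Q1 zero zeroK K sum.distrib
        sum_subtractf swap ip_sum ibr_sum flip: sum_distrib_left sum_distrib_right)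
qed

lemma leib_L2_Higgs:
  "leib Var G (L2_Higgs m mH a b) =
     Rc (m^2 / 4) * (Rc (3 * a + mH^2 / m^2) * (2 * ip (\<lambda>a. G (jPhi a)) phi * Hf ^ 2
         + 2 * ip phi phi * Hf * G jH)
       - Rc (mH^2) * (ip (\<lambda>a. G (jPhi a)) phi * ip phi phi))
     + Rc b * Hf ^ 3 * G jH"
proof -
  have four: "Const (z / 4) * (4 * p) = Const z * p" for z and p :: wick
  proof -
    have "Const z * p = Const (z / 4 * 4) * p"
      by simp
    also have "\<dots> = Const (z / 4) * (4 * p)"
      by (simp only: Const_mult Const_numeral mult.assoc)
    finally show ?thesis
      by simp
  qed
  have ph: "leib Var G (ip phi phi) = 2 * ip (\<lambda>a. G (jPhi a)) phi"
    by (simp add: leib_ip phi_def[abs_def] ip_commute)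
  have "leib Var G (L2_Higgs m mH a b) =
     Rc (m^2 / 4) * (Rc (3 * a + mH^2 / m^2) * (2 * ip (\<lambda>a. G (jPhi a)) phi * Hf ^ 2
         + 2 * ip phi phi * Hf * G jH)
       - Const ((complex_of_real mH)^2 / 4) * (4 * (ip (\<lambda>a. G (jPhi a)) phi * ip phi phi)))
     + Const (complex_of_real b / 4) * (4 * (Hf ^ 3 * G jH))"
    by (simp add: L2_Higgs_def leib_simps ph Hf_def algebra_simps)
  then show ?thesis
    by (simp add: four mult.assoc)
qed

text \<open>By the Jacobi identity each bracket i[X,Y] varies into -i[W, i[X,Y]], which is
  orthogonal to i[X,Y].\<close>

lemma L2_self_gauge_invariant:
  assumes "\<And>\<kappa> a. G (jA \<kappa> a) = - ibr W (Af \<kappa>) a"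
  shows "leib Var G (L2_self cF) = 0"
proof -
  have "ip (ibr X Y) (\<lambda>c. ibr (\<lambda>a. - ibr W X a) Y c + ibr X (\<lambda>a. - ibr W Y a) c) = 0"
    for X Y :: "jet lie"
    by (simp add: ip_def sum_3 ibr_components algebra_simps)
  from this[of "Af \<kappa>" "Af \<sigma>" for \<kappa> \<sigma>] show ?thesis
    by (simp add: leib_L2_self assms flip: Af_def)
qed

text \<open>The F factor of \<open>Q1\<close> gives a gauge transformation, B varies \<phi>, and
  \<partial>H varies H. In \<alpha> and \<beta> the contributions of B and \<partial>H are added,
  with the common prefactor m/2.\<close>

lemma obs_delta_Q1_L2:
  fixes m mH a b :: real
  assumes HK: "HK_two_point c c5 m cF Ob" and m: "m > 0"
  defines "\<alpha> \<equiv> m / 2 * (b - (3 * a + mH^2 / m^2) / 2)"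
    and "\<beta> \<equiv> m / 2 * (m^2 * (3 * a + mH^2 / m^2) / 2 + mH^2 / 4)"
  shows "eqv c c5 m mH (O_Q1_L2_delta Ob c c5 cF m mH a b)
    (place x0 (ip Wf phi * (Rc \<alpha> * Hf ^ 3 + Rc \<beta> * ip phi phi * Hf)) * (Const \<i> * delta x0 x1))"
proof -
  let ?L = "L2 cF m mH a b"
  let ?z = "Const \<i> * delta x0 x1"
  let ?G = "\<lambda>\<mu> \<phi>. leib (\<lambda>j. Var (At x1 j)) (\<lambda>\<psi>. op_apply x0 x1 (delta_part (Ob \<mu> \<phi> \<psi>))) ?L"
  define rF where "rF \<nu> a' \<psi> = (case \<psi> of Jet D f \<Rightarrow> (case f of FA \<kappa> b' \<Rightarrow>
      - (kd a' b' * eta \<nu> \<kappa>) | _ \<Rightarrow> 0))" for \<nu> :: 4 and a' :: 3 and \<psi>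
  define rB where "rB a' \<psi> = (case \<psi> of Jet D f \<Rightarrow> (case f of FPhi b' \<Rightarrow>
      - (kd a' b' / m^2) | _ \<Rightarrow> 0))" for a' :: 3 and \<psi>
  define rH :: "jet \<Rightarrow> real" where "rH \<psi> = (if \<psi> = jH then 1 else 0)" for \<psi>
  \<comment> \<open>The obstruction index is already contracted, so the first index of F and the
    indices of B and \<partial>H do not enter the values.\<close>
  define R where "R \<phi> = (case \<phi> of Jet D f \<Rightarrow> (case f of
      FF \<mu> \<nu> a' \<Rightarrow> leib Var (\<lambda>\<psi>. Rc (rF \<nu> a' \<psi>)) ?L
    | FB \<mu> a' \<Rightarrow> leib Var (\<lambda>\<psi>. Rc (rB a' \<psi>)) ?L
    | FH \<Rightarrow> (if D = {#} then 0 else leib Var (\<lambda>\<psi>. Rc (rH \<psi>)) ?L)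
    | _ \<Rightarrow> 0))" for \<phi>
  have contract: "(\<Sum>\<mu>\<in>UNIV. ?G \<mu> (j \<mu>)) = leib (\<lambda>j. Var (At x1 j))
      (\<lambda>\<psi>. op_apply x0 x1 (delta_part (\<Sum>\<mu>\<in>UNIV. Ob \<mu> (j \<mu>) \<psi>))) ?L" for j :: "4 \<Rightarrow> jet"
    by (simp add: leib_sum_right delta_part_sum op_apply_sum)
  have KF: "place x1 (R (jF 0 \<nu> a')) * ?z = (\<Sum>\<mu>\<in>UNIV. ?G \<mu> (jF \<mu> \<nu> a'))" for \<nu> a'
  proof -
    have "(\<Sum>\<mu>\<in>UNIV. ?G \<mu> (jF \<mu> \<nu> a')) = leib (\<lambda>j. Var (At x1 j)) (\<lambda>\<psi>. place x1 (Rc (rF \<nu> a' \<psi>))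
        * ?z) ?L"
      unfolding contract
      by (rule leib_L2_cong) (simp_all add: HK_F[OF HK] HK_sector[OF HK] rF_def op_apply_opr
          delta_part_opr_mult delta_part_diff delta_part_Iop' opr_mult right_diff_distrib
          flip: opr_uminus)
    then show ?thesis
      by (simp only: leib_place) (simp add: R_def)
  qed
  have KB: "place x1 (R (jB 0 a')) * ?z = (\<Sum>\<mu>\<in>UNIV. ?G \<mu> (jB \<mu> a'))" for a'
  proof -
    have "(\<Sum>\<mu>\<in>UNIV. ?G \<mu> (jB \<mu> a')) = leib (\<lambda>j. Var (At x1 j)) (\<lambda>\<psi>. place x1 (Rc (rB a' \<psi>))
        * ?z) ?L"
      unfolding contract
      by (rule leib_L2_cong) (simp_all add: HK_B[OF HK] HK_sector[OF HK] rB_def op_apply_opr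
          flip: opr_uminus)
    then show ?thesis
      by (simp only: leib_place) (simp add: R_def)
  qed
  have KH: "place x1 (R (jdH 0)) * ?z = (\<Sum>\<mu>\<in>UNIV. ?G \<mu> (jdH \<mu>))"
  proof -
    have "(\<Sum>\<mu>\<in>UNIV. ?G \<mu> (jdH \<mu>)) = leib (\<lambda>j. Var (At x1 j)) (\<lambda>\<psi>. place x1 (Rc (rH \<psi>)) * ?z) ?L"
      unfolding contract
      by (rule leib_L2_cong) (simp_all add: HK_Higgs[OF HK] HK_sector[OF HK] rH_def op_apply_opr
          flip: opr_1)
    then show ?thesis
      by (simp only: leib_place) (simp add: R_def)
  qed
  have "O_Q1_L2_delta Ob c c5 cF m mH a b = (\<Sum>\<mu>\<in>UNIV. leib (\<lambda>j. Var (At x0 j)) (?G \<mu>)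
      (Q1 c c5 m \<mu>))"
    by (simp only: O_Q1_L2_delta_def obs_delta_def obs_eq_leib)
  also have "\<dots> = leib (\<lambda>j. Var (At x0 j)) (\<lambda>\<phi>. place x1 (R \<phi>) * ?z) (Q1 c c5 m 0)"
  proof (rule leib_Q1_contract)
    show "place x1 (R (jF 0 \<nu> a')) * ?z = (\<Sum>\<mu>\<in>UNIV. ?G \<mu> (jF \<mu> \<nu> a'))" for \<nu> a'
      by (rule KF)
    show "place x1 (R (jB 0 a')) * ?z = (\<Sum>\<mu>\<in>UNIV. ?G \<mu> (jB \<mu> a'))" for a'
      by (rule KB)
    show "place x1 (R (jdH 0)) * ?z = (\<Sum>\<mu>\<in>UNIV. ?G \<mu> (jdH \<mu>))"
      by (rule KH)
  qed (simp_all add: L2_zero HK_phi_w[OF HK] HK_sector[OF HK] HK_A[OF HK] HK_Higgs[OF HK] R_def)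
  also have "eqv c c5 m mH \<dots> (place x0 (leib Var R (Q1 c c5 m 0)) * ?z)"
    by (rule leib_delta[unfolded derivation_eq_leib]) simp
  also have "leib Var R (Q1 c c5 m 0) = ip Wf phi * (Rc \<alpha> * Hf ^ 3 + Rc \<beta> * ip phi phi * Hf)"
  proof -
    let ?s = "3 * a + mH^2 / m^2"
    \<comment> \<open>The coefficients of F in \<open>Q1\<close> are pulled into the variation of
      L2, giving the derivation with \<delta>A = -i[w,A], which annihilates \<phi> and H.\<close>
    have "(\<Sum>\<nu>\<in>UNIV. ip (\<lambda>a. R (jF 0 \<nu> a)) (ibr Wf (\<lambda>a. Rc (eta \<nu> \<nu>) * Af \<nu> a)))
        = leib Var (\<lambda>\<psi>. \<Sum>\<nu>\<in>UNIV. \<Sum>a'\<in>UNIV. (Rc (eta \<nu> \<nu>) * ibr Wf (Af \<nu>) a') * Rc (rF \<nu> a' \<psi>)) ?L"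
      by (simp add: ip_def R_def ibr_scale leib_scale flip: leib_sum_right)
        (simp add: mult.commute)
    also have "\<dots> = 0"
    proof -
      let ?D = "\<lambda>\<psi>. \<Sum>\<nu>\<in>UNIV. \<Sum>a'\<in>UNIV. (Rc (eta \<nu> \<nu>) * ibr Wf (Af \<nu>) a') * Rc (rF \<nu> a' \<psi>) :: wick"
      have sum_if: "(\<Sum>i\<in>A. if P then f i else 0) = (if P then \<Sum>i\<in>A. f i else 0)"
        for A P and f :: "3 \<Rightarrow> wick"
        by simp
      have "?D (jA \<kappa> b') = - ibr Wf (Af \<kappa>) b'" for \<kappa> b'
      proof -
        have "?D (jA \<kappa> b') = (\<Sum>\<nu>\<in>UNIV. \<Sum>a'\<in>UNIV. if \<nu> = \<kappa> then if a' = b'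
            then - ibr Wf (Af \<kappa>) b' else 0 else 0)"
          by (intro sum.cong) (auto simp: rF_def kd_def eta_def Const_uminus)
        then show ?thesis
          by (simp add: sum_if)
      qed
      moreover have "?D (jPhi b') = 0" "?D jH = 0" for b'
        by (simp_all add: rF_def)
      ultimately show ?thesis
        by (simp add: L2_def leib_add L2_self_gauge_invariant leib_L2_Higgs ip_zero)
    qed
    finally have F: "(\<Sum>\<nu>\<in>UNIV. ip (\<lambda>a. R (jF 0 \<nu> a)) (ibr Wf (\<lambda>a. Rc (eta \<nu> \<nu>) * Af \<nu> a))) = 0" .
    \<comment> \<open>The value on B is proportional to \<phi>, so the term <\<phi> | i[w,B]> of
      \<open>Q1\<close> drops out and <w | B> becomes a multiple of <w | \<phi>>.\<close>
    define u where "u = Rc (mH^2 / 4) * ip phi phi - Rc (?s / 2) * Hf ^ 2"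
    have B: "R (jB 0 a') = u * phi a'" for a'
    proof -
      have "ip (\<lambda>a. Rc (rB a' (jPhi a))) phi = Rc (- 1 / m^2) * phi a'"
      proof -
        have "ip (\<lambda>a. Rc (rB a' (jPhi a))) phi = (\<Sum>a\<in>UNIV. if a = a' then Rc (- 1 / m^2)
            * phi a' else 0)"
          unfolding ip_def by (rule sum.cong) (auto simp: rB_def kd_def)
        then show ?thesis
          by simp
      qed
      then have "R (jB 0 a') = Rc (m^2 / 4) * (Rc ?s * (Rc 2 * (Rc (- 1 / m^2) * (phi a' * Hf ^ 2)))
          - Rc (mH^2) * (Rc (- 1 / m^2) * (phi a' * ip phi phi)))"
        by (simp add: R_def L2_def leib_add leib_L2_self leib_L2_Higgs rB_def[of _ "jA _ _"]
            rB_def[of _ jH] ibr_zero ip_zero mult.assoc)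
      also have "\<dots> = Rc (m^2 / 4 * (?s * (2 * (- 1 / m^2)))) * (phi a' * Hf ^ 2)
          - Rc (m^2 / 4 * (mH^2 * (- 1 / m^2))) * (phi a' * ip phi phi)"
        by (simp only: Rc_mult right_diff_distrib)
      also have "m^2 / 4 * (?s * (2 * (- 1 / m^2))) = - (?s / 2)"
        using m by (simp add: field_simps)
      also have "m^2 / 4 * (mH^2 * (- 1 / m^2)) = - (mH^2 / 4)"
        using m by (simp add: field_simps)
      finally show ?thesis
        unfolding u_def of_real_minus Const_uminus by (simp add: algebra_simps)
    qed
    have H: "R (jdH 0) = Rc (m^2 / 2 * ?s) * ip phi phi * Hf + Rc b * Hf ^ 3"
    proof -
      have "R (jdH 0) = Rc (m^2 / 4) * (Rc ?s * (Rc 2 * (ip phi phi * Hf))) + Rc b * Hf ^ 3"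
        by (simp add: R_def L2_def leib_add leib_L2_self leib_L2_Higgs rH_def ibr_zero ip_zero
            mult.assoc)
      also have "\<dots> = Rc (m^2 / 4 * (?s * 2)) * (ip phi phi * Hf) + Rc b * Hf ^ 3"
        by (simp only: Rc_mult)
      also have "m^2 / 4 * (?s * 2) = m^2 / 2 * ?s"
        by simp
      finally show ?thesis
        by (simp only: mult.assoc)
    qed
    have "leib Var R (Q1 c c5 m 0) = Rc (m/2) * ip Wf phi * (u * Hf + R (jdH 0))"
    proof -
      have "leib Var R (Q1 c c5 m 0) = (\<Sum>\<nu>\<in>UNIV. ip (\<lambda>a. R (jF 0 \<nu> a)) (ibr Wf (\<lambda>a. Rc (eta \<nu> \<nu>)
          * Af \<nu> a)))
        - Rc (m^2 / 2) * ip phi (ibr Wf (\<lambda>a. R (jB 0 a)))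
        + Rc (m/2) * (ip Wf (\<lambda>a. R (jB 0 a)) * Hf + ip Wf phi * R (jdH 0))"
        by (subst leib_Q1) (simp_all add: R_def Wf_def[abs_def] Af_def phi_def[abs_def] Hf_def)
      also have "ip phi (ibr Wf (\<lambda>a. R (jB 0 a))) = 0"
        unfolding B by (simp add: ibr_scale[abs_def] ip_scale ip_ibr_self)
      also have "ip Wf (\<lambda>a. R (jB 0 a)) = u * ip Wf phi"
        unfolding B by (simp add: ip_scale)
      finally show ?thesis
        unfolding F by (simp add: algebra_simps)
    qed
    also have "\<dots> = ip Wf phi * ((Rc (m/2) * Rc b - Rc (m/2) * Rc (?s / 2)) * Hf ^ 3
        + (Rc (m/2) * Rc (mH^2 / 4) + Rc (m/2) * Rc (m^2 / 2 * ?s)) * ip phi phi * Hf)"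
      unfolding u_def H by (simp add: algebra_simps power3_eq_cube power2_eq_square)
    also have "Rc (m/2) * Rc b - Rc (m/2) * Rc (?s / 2) = (Rc \<alpha> :: wick)"
      by (simp only: Rc_mult Const_diff[symmetric] of_real_diff[symmetric] \<alpha>_def right_diff_distrib)
    also have "Rc (m/2) * Rc (mH^2 / 4) + Rc (m/2) * Rc (m^2 / 2 * ?s) = (Rc \<beta> :: wick)"
    proof -
      have "x / 2 * (y / 4) + x / 2 * (z / 2 * t) = x / 2 * (z * t / 2 + y / 4)" for x y z t :: real
        by (simp add: field_simps)
      then show ?thesis
        by (simp only: Rc_mult Const_add[symmetric] of_real_add[symmetric] \<beta>_def)
    qed
    finally show ?thesis .
  qed
  finally show ?thesis .
qed

section \<open>The Higgs potential\<close>

text \<open>Selecting the pure H monomials is setting all other variables to 0, a homomorphism that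
  can be evaluated on products.\<close>

lemma H_part_eq_poly_subst: "H_part p = poly_subst (\<lambda>j. if j = jH then Var jH else 0) p"
proof -
  let ?F = "\<lambda>k c. if Poly_Mapping.keys k \<subseteq> {jH} then Poly_Mapping.single k c else 0"
  have H_part_eq: "H_part p = (\<Sum>k\<in>Poly_Mapping.keys p. ?F k (Poly_Mapping.lookup p k))" for p
    unfolding H_part_def by (rule sum.inter_filter) simp
  have H_part_add: "H_part (p + q) = H_part p + H_part q" for p q
    unfolding H_part_eq by (rule sum_keys_add) (simp_all add: single_add)
  have H_part_single: "H_part (Poly_Mapping.single k c) = ?F k c" for k c
    unfolding H_part_eq by (rule sum_keys_single) simp
  have H_part_Var_mult: "H_part (Var v * p) = (if v = jH then Var jH * H_part p else 0)" for v p
  proof (induction p rule: poly_mapping_single_add_induct)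
    case (single k c)
    have "Poly_Mapping.keys (Poly_Mapping.single v 1 + k) = insert v (Poly_Mapping.keys k)"
      by (auto simp: in_keys_iff lookup_add lookup_single when_def split: if_splits)
    then show ?case
      by (simp add: Var_def mult_single H_part_single)
  qed (simp add: H_part_add distrib_left)
  show ?thesis
  proof (induction p rule: mpoly_induct)
    case (Const z)
    then show ?case
      by (simp add: H_part_single Const_def[of z] poly_subst_single)
  qed (simp_all add: H_part_add H_part_Var_mult poly_subst_simps)
qed

lemma shifted_double_well_Higgs_potential:
  assumes "m > 0" "mH > 0" "g \<noteq> 0"
  shows "shifted_double_well (Higgs_potential g c c5 cF m mH (- (1/2) * (mH^2 / m^2))
    (- (1/4) * (mH^2 / m^2)))"
proof -
  let ?a = "- (1/2) * (mH^2 / m^2)" and ?b = "- (1/4) * (mH^2 / m^2)"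
  \<comment> \<open>The H^4 coefficient fixes \<alpha>, and the H^3 coefficient 2 \<alpha> v then
    fixes v; the mass term agrees with \<alpha> v^2.\<close>
  let ?\<alpha> = "g^2 * mH^2 / (32 * m^2)" and ?v = "4 * m / g"
  have "H_part (Rc g * L1 c c5 m mH ?a + Rc (g^2 / 2) * L2 cF m mH ?a ?b)
      = Rc g * (Rc (m/2) * (Rc ?a * Hf ^ 3)) + Rc (g^2 / 2) * (Rc (?b / 4) * Hf ^ 4)"
    by (simp add: H_part_eq_poly_subst L1_def L2_def L2_self_eq L2_Higgs_def low_eq
        poly_subst_simps
        poly_subst_ip poly_subst_ibr[abs_def] ip_zero ibr_zero Af_def Bf_def Ff_def phi_def Hf_def dHf_def Jf_def)
  then have "Higgs_potential g c c5 cF m mH ?a ?b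
      = Rc (mH^2 / 2) * Hf ^ 2 + Rc (- (g * (m/2 * ?a))) * Hf ^ 3 + Rc (- (g^2 / 2 * (?b / 4)))
          * Hf ^ 4"
    unfolding Higgs_potential_def by (simp only: Rc_mult Const_uminus of_real_minus) simp
  also have "mH^2 / 2 = ?\<alpha> * (?v * ?v)"
    using assms by (simp add: field_simps power2_eq_square)
  also have "- (g * (m/2 * ?a)) = ?\<alpha> * (2 * ?v)"
    using assms by (simp add: field_simps power2_eq_square)
  also have "- (g^2 / 2 * (?b / 4)) = ?\<alpha>"
    using assms by (simp add: field_simps)
  also have "Rc (?\<alpha> * (?v * ?v)) * Hf ^ 2 + Rc (?\<alpha> * (2 * ?v)) * Hf ^ 3 + Rc ?\<alpha> * Hf ^ 4
      = Rc ?\<alpha> * (Rc ?v * (Rc ?v * Hf ^ 2) + 2 * (Rc ?v * Hf ^ 3) + Hf ^ 4)"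
    by (simp only: of_real_mult Const_mult distrib_left mult.assoc of_real_numeral Const_numeral)
  also have "\<dots> = Rc ?\<alpha> * Hf ^ 2 * (Hf + Rc ?v) ^ 2"
  proof -
    have "x * (x * h ^ 2) + 2 * (x * h ^ 3) + h ^ 4 = h ^ 2 * (h + x) ^ 2" for x h :: wick
      by (simp add: power2_eq_square power3_eq_cube power4_eq_xxxx algebra_simps)
    then show ?thesis
      by (simp only: mult.assoc)
  qed
  finally show ?thesis
    using assms unfolding shifted_double_well_def by (intro exI[of _ ?\<alpha>] exI[of _ ?v]) simp
qed

section \<open>Assembly of the third-order result\<close>

theorem proposition4p4:
  fixes m mH cF a b c c5 g :: real
    and Ob :: two_point and Ow2 :: w2_two_point
  assumes "m > 0" and "mH > 0" and "g \<noteq> 0"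
    and "(c, c5) \<in> {(1, 0), (1/2, 1/2), (1/2, -1/2)}"
    and "HK_two_point c c5 m cF Ob"
  shows "eqv c c5 m mH (obs_delta Ob x0 x2 (Q2_loc cF) (L1 c c5 m mH a)) 0 \<and>
    eqv c c5 m mH (T_Q2_delta Ob c c5 cF m mH a) 0 \<and>
    (eqv c c5 m mH (O_Q1_L2_delta Ob c c5 cF m mH a b) 0 \<longleftrightarrow>
      a = - (1/2) * (mH^2 / m^2) \<and> b = - (1/4) * (mH^2 / m^2)) \<and>
    (a = - (1/2) * (mH^2 / m^2) \<and> b = - (1/4) * (mH^2 / m^2) \<longrightarrow>
      shifted_double_well (Higgs_potential g c c5 cF m mH a b) \<and>
      eqv c c5 m mH
        (Rc 3 * symm (T_Q2_delta Ob c c5 cF m mH a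
                      + O_Q1_L2_delta Ob c c5 cF m mH a b * delta x1 x2))
        (resolution 0 (\<lambda>\<mu>. 0)) \<and>
      (eq_der c c5 m mH (O3 Ob Ow2 c c5 cF m mH a b)
         (Rc 3 * symm (T_w2 Ow2 c c5 m mH a
                       + T_Q2_string Ob c c5 cF m mH a
                       + T_Q2_delta Ob c c5 cF m mH a
                       + O_Q1_L2_delta Ob c c5 cF m mH a b * delta x1 x2)) \<and>
       eq_der c c5 m mH (Rc 3 * symm (T_w2 Ow2 c c5 m mH a)) 0 \<and>
       eq_der c c5 m mH (Rc 3 * symm (T_Q2_string Ob c c5 cF m mH a)) 0 \<longrightarrow>
       eq_der c c5 m mH (O3 Ob Ow2 c c5 cF m mH a b) (resolution 0 (\<lambda>\<mu>. 0))))"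
proof -
  let ?a = "- (1/2) * (mH^2 / m^2)" and ?b = "- (1/4) * (mH^2 / m^2)"
  let ?O = "O_Q1_L2_delta Ob c c5 cF m mH a b"
  have Q2: "eqv c c5 m mH (obs_delta Ob x0 x2 (Q2_loc cF) (L1 c c5 m mH a)) 0"
    by (rule obs_delta_Q2_loc_L1) fact
  have T: "eqv c c5 m mH (T_Q2_delta Ob c c5 cF m mH a) 0"
    using eqv_mult_right[OF eqv_mult_left[OF Q2], of "Rc (1/2)" "delta x0 x1"]
    by (simp add: T_Q2_delta_def)
  define \<alpha> where "\<alpha> = m / 2 * (b - (3 * a + mH^2 / m^2) / 2)"
  define \<beta> where "\<beta> = m / 2 * (m^2 * (3 * a + mH^2 / m^2) / 2 + mH^2 / 4)"
  have O: "eqv c c5 m mH ?O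
    (place x0 (ip Wf phi * (Rc \<alpha> * Hf ^ 3 + Rc \<beta> * ip phi phi * Hf)) * (Const \<i> * delta x0 x1))"
    unfolding \<alpha>_def \<beta>_def by (rule obs_delta_Q1_L2) fact+
  have "eqv c c5 m mH ?O 0 \<longleftrightarrow> \<alpha> = 0 \<and> \<beta> = 0"
  proof
    assume "eqv c c5 m mH ?O 0"
    \<comment> \<open>If the obstruction vanishes, so does its evaluated form, which the functional
      permits only for zero coefficients.\<close>
    from eqv_trans[OF eqv_sym[OF O] this] show "\<alpha> = 0 \<and> \<beta> = 0"
      unfolding eqv_def by (intro quartic_not_null) simp
  qed (use O in simp)
  also have "\<dots> \<longleftrightarrow> a = ?a \<and> b = ?b"
  proof -
    \<comment> \<open>The term with <\<phi>|\<phi>> H determines a alone; given this a, the H^3 term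
      determines b.\<close>
    have "\<beta> = 0 \<longleftrightarrow> a = ?a"
    proof -
      have "\<beta> = 3 / 4 * m ^ 3 * (a - ?a)"
        using \<open>m > 0\<close> by (simp add: \<beta>_def field_simps power2_eq_square power3_eq_cube)
      then show ?thesis
        using \<open>m > 0\<close> unfolding eq_iff_diff_eq_0[of a ?a] by (simp only: mult_eq_0_iff) simp
    qed
    moreover have "\<alpha> = 0 \<longleftrightarrow> b = ?b" if "a = ?a"
    proof -
      have "\<alpha> = m / 2 * (b - ?b)"
        using \<open>m > 0\<close> unfolding \<alpha>_def that by (simp add: field_simps)
      then show ?thesis
        using \<open>m > 0\<close> unfolding eq_iff_diff_eq_0[of b ?b] by (simp only: mult_eq_0_iff) simp
    qed
    ultimately show ?thesis
      by blast
  qed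
  finally have iff: "eqv c c5 m mH ?O 0 \<longleftrightarrow> a = ?a \<and> b = ?b" .
  show ?thesis
  proof (intro conjI impI Q2 T iff)
    assume ab: "a = ?a \<and> b = ?b"
    then show "shifted_double_well (Higgs_potential g c c5 cF m mH a b)"
      using shifted_double_well_Higgs_potential[OF assms(1-3)] by blast
    have "T_Q2_delta Ob c c5 cF m mH a + ?O * delta x1 x2 \<in> null_ideal c c5 m mH"
      using eqv_add[OF T eqv_mult_right] iff ab by (fastforce simp: eqv_def)
    then have local: "eqv c c5 m mH (Rc 3 * symm (T_Q2_delta Ob c c5 cF m mH a + ?O
        * delta x1 x2)) 0"
      by (simp only: eqv_def diff_zero) (intro null_ideal.mult symm_null_ideal)
    then show "eqv c c5 m mH (Rc 3 * symm (T_Q2_delta Ob c c5 cF m mH a + ?O * delta x1 x2))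
        (resolution 0 (\<lambda>\<mu>. 0))"
      by simp
    assume der: "eq_der c c5 m mH (O3 Ob Ow2 c c5 cF m mH a b)
         (Rc 3 * symm (T_w2 Ow2 c c5 m mH a + T_Q2_string Ob c c5 cF m mH a
           + T_Q2_delta Ob c c5 cF m mH a + ?O * delta x1 x2)) \<and>
       eq_der c c5 m mH (Rc 3 * symm (T_w2 Ow2 c c5 m mH a)) 0 \<and>
       eq_der c c5 m mH (Rc 3 * symm (T_Q2_string Ob c c5 cF m mH a)) 0"
    \<comment> \<open>The first two terms are total derivatives by assumption and the local
      remainder vanishes; linearity of \<open>symm\<close> reassembles the displayed form of the
      obstruction.\<close>
    have "eq_der c c5 m mH (Rc 3 * symm (T_w2 Ow2 c c5 m mH a)
        + Rc 3 * symm (T_Q2_string Ob c c5 cF m mH a)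
        + Rc 3 * symm (T_Q2_delta Ob c c5 cF m mH a + ?O * delta x1 x2)) (0 + 0 + 0)"
      using der eq_der_of_eqv[OF local] by (intro eq_der_add) blast+
    then have "eq_der c c5 m mH (Rc 3 * symm (T_w2 Ow2 c c5 m mH a + T_Q2_string Ob c c5 cF m mH a
        + T_Q2_delta Ob c c5 cF m mH a + ?O * delta x1 x2)) 0"
      by (simp add: symm_add algebra_simps)
    then show "eq_der c c5 m mH (O3 Ob Ow2 c c5 cF m mH a b) (resolution 0 (\<lambda>\<mu>. 0))"
      using eq_der_trans der by (metis resolution_0)
  qed
qed

end
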